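(* Let $P$ be a non-speculative program with input selectability and $P'$ a simply typed program corresponding to $P$. Let $Q$ be a permutation simply typed query and $Q'$ a simply typed query corresponding to $Q$. If there is an infinite delay-respecting derivation of $P\cup\{Q\}$, then there is an infinite LD-derivation of $P'\cup\{Q'\}$.
   Context: Basics. A query is a finite sequence of atoms; a clause is $h\leftarrow B$ with $h$ an atom and $B$ a query. Every predicate has a fixed mode, i.e. each argument position is either input or output; $p(\mathbf s,\mathbf t)$ denotes an atom with $\mathbf s$ (resp. $\mathbf t$) the vector of terms filling the input (resp. output) positions. In clause heads $p(\mathbf t_0,\mathbf s_{n+1})$, $\mathbf t_0$ is the input and $\mathbf s_{n+1}$ the output. A syntactic object is linear if each variable occurs in it at most once. A clause is input-linear if the vector of input terms of its head is linear; a program is input-linear if all its clauses are and it does not use the equality predicate $=$ with both arguments input. A flat term is a variable or a term $f(x_1,\dots,x_n)$, $n\ge 0$, with distinct variables $x_i$. A permutation $\pi$ on $\{1,\dots,n\}$ is extended by $\pi(i)=i$ outside $\{1,\dots,n\}$, and $\pi(o_1,\dots,o_n)=o_{\pi^{-1}(1)},\dots,o_{\pi^{-1}(n)}$. Types. A type is a set of terms closed under instantiation. The variable type is the type of all terms; any other type is a non-variable type. Each argument position of each predicate has an associated type. $t:T$ means $t\in T$ (componentwise for vectors); $\models \varphi\Rightarrow \mathbf t:\mathbf T$ means that the implication holds after applying any substitution to all terms. A term is type-consistent (in a position of type $T$) if some instance of it is in $T$. Nicely moded. $Q=p_1(\mathbf s_1,\mathbf t_1),\dots,p_n(\mathbf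 s_n,\mathbf t_n)$ is $\pi$-nicely moded if $\mathbf t_1,\dots,\mathbf t_n$ is linear and for all $i$, $vars(\mathbf s_i)\cap\bigcup_{\pi(i)\le\pi(j)\le n}vars(\mathbf t_j)=\emptyset$. A clause $p(\mathbf t_0,\mathbf s_{n+1})\leftarrow Q$ is $\pi$-nicely moded if $Q$ is and $vars(\mathbf t_0)\cap\bigcup_{j=1}^n vars(\mathbf t_j)=\emptyset$. Well typed. With $p_i(\mathbf S_i,\mathbf T_i)$ the type of $p_i$, $Q$ is $\pi$-well typed if for all $i\in\{1,\dots,n\}$, $\models(\bigwedge_{1\le\pi(j)<\pi(i)}\mathbf t_j:\mathbf T_j)\Rightarrow\mathbf s_i:\mathbf S_i$. A clause $p(\mathbf t_0,\mathbf s_{n+1})\leftarrow Q$, with $p(\mathbf T_0,\mathbf S_{n+1})$ the type of $p$, is $\pi$-well typed if for all $i\in\{1,\dots,n+1\}$, $\models(\bigwedge_{0\le\pi(j)<\pi(i)}\mathbf t_j:\mathbf T_j)\Rightarrow\mathbf s_i:\mathbf S_i$. Simply typed. $Q$ is $\pi$-simply typed if it is $\pi$-nicely moded and $\pi$-well typed and $\mathbf t_1,\dots,\mathbf t_n$ is a vector of variables. A clause $p(\mathbf t_0,\mathbf s_{n+1})\leftarrow Q$ is $\pi$-simply typed if it is $\pi$-nicely moded and $\pi$-well typed, $\mathbf t_1,\dots,\mathbf t_n$ is a vector of variables, and $\mathbf t_0$ is a vector of flat type-consistent terms that has a variable in each position of variable type. "Permutation simply typed" means $\pi$-simply typed for some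 $\pi$ (for each clause, for programs); "simply typed" means this with $\pi$ the identity. A simply typed query (clause) corresponding to a $\pi$-simply typed query $Q$ (clause $h\leftarrow B$) is $\pi(Q)$ (resp. $h\leftarrow\pi(B)$); a simply typed program corresponding to $P$ is obtained by replacing every clause by a simply typed clause corresponding to it. Bound/free. An input position of a predicate $p$ is bound (in $P$) if some clause head $p(\dots)$ in $P$ has a non-variable term there; an output position is bound if some body atom $p(\dots)$ in $P$ has a non-variable term there; otherwise it is free. (In a permutation simply typed program all output positions are free.) Derivations. A program consists of clauses and, for each predicate $p/n$, a block declaration: a (possibly empty) set of atoms $p(b_1,\dots,b_n)$ with $b_i\in\{?,-\}$. An atom $p(t_1,\dots,t_n)$ is blocked if for some $p(b_1,\dots,b_n)$ in the declaration, $t_i$ is a variable for all $i$ with $b_i=-$; otherwise it is selectable. In a derivation step a query $Q_1,a,Q_2$ is replaced by $(Q_1,B,Q_2)\theta$, where $h\leftarrow B$ is a variant, renamed apart, of a program clause and $\theta$ is a most general unifier of the selected atom $a$ and $h$. A derivation of $P\cup\{Q\}$ is a (finite or infinite) sequence of such steps starting at $Q$. An LD-derivation always selects the leftmost atom (ignoring block declarations). A delay-respecting derivation always selects a selectable atom. Input selectability. A permutation simply typed program $P$ has input selectability if every atom (using a predicate of $P$) that has variables in all free output positions is selectable in $P$ (1) only if it is non-variable in all bound input positions, and (2) if it is non-variable in all input positions of non-variable type. Non-speculative. A program $P$ is non-speculative if it is permutation simply typed and input-linear, and every simply typed atom (i.e. one-atom query) using a predicate in $P$ is unifiable with some (renamed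 apart) clause head in $P$.
   Formalization: The query Q is required to use only predicates occurring in P; otherwise the claim fails, e.g. for P = {p ← p} and Q = q(X), p with q not in P: p can be selected forever, while the LD-derivation is stuck at q(X). *)

theory Defs
  imports "HOL-Combinatorics.Permutations"
begin

section \<open>Terms, atoms, clauses\<close>

datatype 'f trm = is_Var: Var nat | Fun 'f "'f trm list"

type_synonym 'f subst = "nat \<Rightarrow> 'f trm"

primrec subst_trm :: "'f subst \<Rightarrow> 'f trm \<Rightarrow> 'f trm" where
  "subst_trm \<sigma> (Var x) = \<sigma> x"
| "subst_trm \<sigma> (Fun f ts) = Fun f (map (subst_trm \<sigma>) ts)"

text \<open>The list of all variable occurrences, with repetitions; linearity is read off from it.\<close>

primrec occs :: "'f trm \<Rightarrow> nat list" where
  "occs (Var x) = [x]"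
| "occs (Fun f ts) = concat (map occs ts)"

definition occs_list :: "'f trm list \<Rightarrow> nat list" where
  "occs_list ts = concat (map occs ts)"

definition linear :: "'f trm list \<Rightarrow> bool" where
  "linear ts \<longleftrightarrow> distinct (occs_list ts)"

definition vars_list :: "'f trm list \<Rightarrow> nat set" where
  "vars_list ts = set (occs_list ts)"

definition flat :: "'f trm \<Rightarrow> bool" where
  "flat t \<longleftrightarrow> is_Var t \<or> (\<exists>f xs. t = Fun f (map Var xs) \<and> distinct xs)"

text \<open>The equality predicate is singled out only because input-linearity refers to it.
  Derivations resolve it, like every other predicate, with its clauses in the program
  (conventionally the single fact \<open>X = X\<close>).\<close>

datatype 'p psym = Eq | Psym 'p

datatype ('f, 'p) atom = Atom (psym: "'p psym") (args: "'f trm list")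

type_synonym ('f, 'p) query = "('f, 'p) atom list"
type_synonym ('f, 'p) clause = "('f, 'p) atom \<times> ('f, 'p) query"

definition subst_atom :: "'f subst \<Rightarrow> ('f, 'p) atom \<Rightarrow> ('f, 'p) atom" where
  "subst_atom \<sigma> a = Atom (psym a) (map (subst_trm \<sigma>) (args a))"

definition subst_query :: "'f subst \<Rightarrow> ('f, 'p) query \<Rightarrow> ('f, 'p) query" where
  "subst_query \<sigma> Q = map (subst_atom \<sigma>) Q"

definition vars_atom :: "('f, 'p) atom \<Rightarrow> nat set" where
  "vars_atom a = vars_list (args a)"

definition vars_query :: "('f, 'p) query \<Rightarrow> nat set" where
  "vars_query Q = (\<Union>a\<in>set Q. vars_atom a)"


section \<open>The underlying language: function symbols, modes, types\<close>

datatype mode = Input | Output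

text \<open>A function symbol is a name together with an arity.  The arity of a predicate \<open>p\<close> is the
  length of \<open>mode L p\<close>.  Argument positions are counted from 0.\<close>

record ('f, 'p) language =
  funs :: "('f \<times> nat) set"
  mode :: "'p psym \<Rightarrow> mode list"
  ptype :: "'p psym \<Rightarrow> 'f trm set list"

primrec wf_trm :: "('f, 'p) language \<Rightarrow> 'f trm \<Rightarrow> bool" where
  "wf_trm L (Var x) \<longleftrightarrow> True"
| "wf_trm L (Fun f ts) \<longleftrightarrow> (f, length ts) \<in> funs L \<and> list_all (wf_trm L) ts"

definition wf_subst :: "('f, 'p) language \<Rightarrow> 'f subst \<Rightarrow> bool" where
  "wf_subst L \<sigma> \<longleftrightarrow> (\<forall>x. wf_trm L (\<sigma> x))"

definition is_type :: "('f, 'p) language \<Rightarrow> 'f trm set \<Rightarrow> bool" where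
  "is_type L T \<longleftrightarrow> T \<subseteq> {t. wf_trm L t} \<and>
     (\<forall>t\<in>T. \<forall>\<sigma>. wf_subst L \<sigma> \<longrightarrow> subst_trm \<sigma> t \<in> T)"

definition variable_type :: "('f, 'p) language \<Rightarrow> 'f trm set" where
  "variable_type L = {t. wf_trm L t}"

definition type_consistent :: "('f, 'p) language \<Rightarrow> 'f trm \<Rightarrow> 'f trm set \<Rightarrow> bool" where
  "type_consistent L t T \<longleftrightarrow> (\<exists>\<sigma>. wf_subst L \<sigma> \<and> subst_trm \<sigma> t \<in> T)"

definition wf_language :: "('f, 'p) language \<Rightarrow> bool" where
  "wf_language L \<longleftrightarrow> length (mode L Eq) = 2 \<and>
     (\<forall>p. length (ptype L p) = length (mode L p) \<and> (\<forall>T\<in>set (ptype L p). is_type L T))"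

definition wf_atom :: "('f, 'p) language \<Rightarrow> ('f, 'p) atom \<Rightarrow> bool" where
  "wf_atom L a \<longleftrightarrow>
     length (args a) = length (mode L (psym a)) \<and> (\<forall>t\<in>set (args a). wf_trm L t)"

definition positions :: "('f, 'p) language \<Rightarrow> 'p psym \<Rightarrow> mode \<Rightarrow> nat set" where
  "positions L p m = {i. i < length (mode L p) \<and> mode L p ! i = m}"

text \<open>\<open>ins L a\<close> and \<open>outs L a\<close> are the vectors \<open>s\<close> and \<open>t\<close> of an atom written \<open>p(s,t)\<close>.\<close>

definition ins :: "('f, 'p) language \<Rightarrow> ('f, 'p) atom \<Rightarrow> 'f trm list" where
  "ins L a = nths (args a) (positions L (psym a) Input)"

definition outs :: "('f, 'p) language \<Rightarrow> ('f, 'p) atom \<Rightarrow> 'f trm list" where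
  "outs L a = nths (args a) (positions L (psym a) Output)"

definition ins_typed :: "('f, 'p) language \<Rightarrow> ('f, 'p) atom \<Rightarrow> bool" where
  "ins_typed L a \<longleftrightarrow> (\<forall>i\<in>positions L (psym a) Input. args a ! i \<in> ptype L (psym a) ! i)"

definition outs_typed :: "('f, 'p) language \<Rightarrow> ('f, 'p) atom \<Rightarrow> bool" where
  "outs_typed L a \<longleftrightarrow> (\<forall>i\<in>positions L (psym a) Output. args a ! i \<in> ptype L (psym a) ! i)"


section \<open>Nicely moded, well typed and simply typed queries and clauses\<close>

text \<open>The atoms of a query are numbered \<open>1, \<dots>, n\<close>, so that \<open>0\<close> and \<open>n + 1\<close> are free to stand
  for the clause head.  A permutation of \<open>{1..n}\<close> in the sense of \<^const>\<open>permutes\<close> is the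
  identity outside \<open>{1..n}\<close>.\<close>

abbreviation nth_atom :: "('f, 'p) query \<Rightarrow> nat \<Rightarrow> ('f, 'p) atom" where
  "nth_atom Q i \<equiv> Q ! (i - 1)"

definition permute_query :: "(nat \<Rightarrow> nat) \<Rightarrow> ('f, 'p) query \<Rightarrow> ('f, 'p) query" where
  "permute_query \<pi> Q = map (\<lambda>i. nth_atom Q (inv \<pi> i)) [1..<Suc (length Q)]"

definition nicely_moded_query ::
  "('f, 'p) language \<Rightarrow> (nat \<Rightarrow> nat) \<Rightarrow> ('f, 'p) query \<Rightarrow> bool" where
  "nicely_moded_query L \<pi> Q \<longleftrightarrow>
     linear (concat (map (outs L) Q)) \<and>
     (\<forall>i\<in>{1..length Q}.
        vars_list (ins L (nth_atom Q i)) \<inter>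
        (\<Union>j\<in>{j\<in>{1..length Q}. \<pi> i \<le> \<pi> j}. vars_list (outs L (nth_atom Q j))) = {})"

fun nicely_moded_clause ::
  "('f, 'p) language \<Rightarrow> (nat \<Rightarrow> nat) \<Rightarrow> ('f, 'p) clause \<Rightarrow> bool" where
  "nicely_moded_clause L \<pi> (h, B) \<longleftrightarrow>
     nicely_moded_query L \<pi> B \<and>
     vars_list (ins L h) \<inter> (\<Union>j\<in>{1..length B}. vars_list (outs L (nth_atom B j))) = {}"

definition well_typed_query ::
  "('f, 'p) language \<Rightarrow> (nat \<Rightarrow> nat) \<Rightarrow> ('f, 'p) query \<Rightarrow> bool" where
  "well_typed_query L \<pi> Q \<longleftrightarrow>
     (\<forall>i\<in>{1..length Q}. \<forall>\<sigma>. wf_subst L \<sigma> \<longrightarrow>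
        (\<forall>j\<in>{1..length Q}. \<pi> j < \<pi> i \<longrightarrow> outs_typed L (subst_atom \<sigma> (nth_atom Q j))) \<longrightarrow>
        ins_typed L (subst_atom \<sigma> (nth_atom Q i)))"

text \<open>\<open>produced_typed L h B \<sigma> j\<close> is \<open>t\<^sub>j\<sigma> : T\<^sub>j\<close> and \<open>consumed_typed L h B \<sigma> i\<close> is
  \<open>s\<^sub>i\<sigma> : S\<^sub>i\<close>, for the clause \<open>p(t\<^sub>0, s\<^bsub>n+1\<^esub>) \<leftarrow> p\<^sub>1(s\<^sub>1, t\<^sub>1), \<dots>, p\<^sub>n(s\<^sub>n, t\<^sub>n)\<close>.\<close>

definition produced_typed ::
  "('f, 'p) language \<Rightarrow> ('f, 'p) atom \<Rightarrow> ('f, 'p) query \<Rightarrow> 'f subst \<Rightarrow> nat \<Rightarrow> bool" where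
  "produced_typed L h B \<sigma> j \<longleftrightarrow>
     (if j = 0 then ins_typed L (subst_atom \<sigma> h)
      else outs_typed L (subst_atom \<sigma> (nth_atom B j)))"

definition consumed_typed ::
  "('f, 'p) language \<Rightarrow> ('f, 'p) atom \<Rightarrow> ('f, 'p) query \<Rightarrow> 'f subst \<Rightarrow> nat \<Rightarrow> bool" where
  "consumed_typed L h B \<sigma> i \<longleftrightarrow>
     (if i = length B + 1 then outs_typed L (subst_atom \<sigma> h)
      else ins_typed L (subst_atom \<sigma> (nth_atom B i)))"

fun well_typed_clause ::
  "('f, 'p) language \<Rightarrow> (nat \<Rightarrow> nat) \<Rightarrow> ('f, 'p) clause \<Rightarrow> bool" where
  "well_typed_clause L \<pi> (h, B) \<longleftrightarrow>
     (\<forall>i\<in>{1..length B + 1}. \<forall>\<sigma>. wf_subst L \<sigma> \<longrightarrow>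
        (\<forall>j\<in>{0..length B}. \<pi> j < \<pi> i \<longrightarrow> produced_typed L h B \<sigma> j) \<longrightarrow>
        consumed_typed L h B \<sigma> i)"

definition pi_simply_typed_query ::
  "('f, 'p) language \<Rightarrow> (nat \<Rightarrow> nat) \<Rightarrow> ('f, 'p) query \<Rightarrow> bool" where
  "pi_simply_typed_query L \<pi> Q \<longleftrightarrow>
     \<pi> permutes {1..length Q} \<and> nicely_moded_query L \<pi> Q \<and> well_typed_query L \<pi> Q \<and>
     (\<forall>a\<in>set Q. \<forall>t\<in>set (outs L a). is_Var t)"

fun pi_simply_typed_clause ::
  "('f, 'p) language \<Rightarrow> (nat \<Rightarrow> nat) \<Rightarrow> ('f, 'p) clause \<Rightarrow> bool" where
  "pi_simply_typed_clause L \<pi> (h, B) \<longleftrightarrow>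
     \<pi> permutes {1..length B} \<and>
     nicely_moded_clause L \<pi> (h, B) \<and> well_typed_clause L \<pi> (h, B) \<and>
     (\<forall>a\<in>set B. \<forall>t\<in>set (outs L a). is_Var t) \<and>
     (\<forall>i\<in>positions L (psym h) Input.
        flat (args h ! i) \<and> type_consistent L (args h ! i) (ptype L (psym h) ! i) \<and>
        (ptype L (psym h) ! i = variable_type L \<longrightarrow> is_Var (args h ! i)))"

definition perm_simply_typed_query :: "('f, 'p) language \<Rightarrow> ('f, 'p) query \<Rightarrow> bool" where
  "perm_simply_typed_query L Q \<longleftrightarrow> (\<exists>\<pi>. pi_simply_typed_query L \<pi> Q)"

definition simply_typed_atom :: "('f, 'p) language \<Rightarrow> ('f, 'p) atom \<Rightarrow> bool" where
  "simply_typed_atom L a \<longleftrightarrow> pi_simply_typed_query L id [a]"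

definition corresponding_query ::
  "('f, 'p) language \<Rightarrow> ('f, 'p) query \<Rightarrow> ('f, 'p) query \<Rightarrow> bool" where
  "corresponding_query L Q Q' \<longleftrightarrow>
     (\<exists>\<pi>. pi_simply_typed_query L \<pi> Q \<and> Q' = permute_query \<pi> Q)"

fun corresponding_clause ::
  "('f, 'p) language \<Rightarrow> ('f, 'p) clause \<Rightarrow> ('f, 'p) clause \<Rightarrow> bool" where
  "corresponding_clause L (h, B) c' \<longleftrightarrow>
     (\<exists>\<pi>. pi_simply_typed_clause L \<pi> (h, B) \<and> c' = (h, permute_query \<pi> B))"


section \<open>Programs with block declarations\<close>

datatype block_mark = Question | Dash

record ('f, 'p) program =
  clauses :: "('f, 'p) clause set"
  block :: "'p psym \<Rightarrow> block_mark list set"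

definition wf_program :: "('f, 'p) language \<Rightarrow> ('f, 'p) program \<Rightarrow> bool" where
  "wf_program L P \<longleftrightarrow>
     (\<forall>(h, B)\<in>clauses P. \<forall>a\<in>set (h # B). wf_atom L a) \<and>
     (\<forall>p. \<forall>b\<in>block P p. length b = length (mode L p))"

definition preds :: "('f, 'p) program \<Rightarrow> 'p psym set" where
  "preds P = (\<Union>(h, B)\<in>clauses P. psym ` set (h # B))"

text \<open>The queries posed to a program are those over the predicates of the program.\<close>

definition query_for :: "('f, 'p) language \<Rightarrow> ('f, 'p) program \<Rightarrow> ('f, 'p) query \<Rightarrow> bool" where
  "query_for L P Q \<longleftrightarrow> (\<forall>a\<in>set Q. wf_atom L a \<and> psym a \<in> preds P)"

definition perm_simply_typed_program :: "('f, 'p) language \<Rightarrow> ('f, 'p) program \<Rightarrow> bool" where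
  "perm_simply_typed_program L P \<longleftrightarrow> (\<forall>c\<in>clauses P. \<exists>\<pi>. pi_simply_typed_clause L \<pi> c)"

definition corresponding_program ::
  "('f, 'p) language \<Rightarrow> ('f, 'p) program \<Rightarrow> ('f, 'p) program \<Rightarrow> bool" where
  "corresponding_program L P P' \<longleftrightarrow>
     (\<exists>f. (\<forall>c\<in>clauses P. corresponding_clause L c (f c)) \<and>
          P' = P\<lparr>clauses := f ` clauses P\<rparr>)"

definition input_linear_program :: "('f, 'p) language \<Rightarrow> ('f, 'p) program \<Rightarrow> bool" where
  "input_linear_program L P \<longleftrightarrow>
     (\<forall>(h, B)\<in>clauses P. linear (ins L h)) \<and>
     \<not> (Eq \<in> preds P \<and> mode L Eq = [Input, Input])"

definition bound_position ::
  "('f, 'p) language \<Rightarrow> ('f, 'p) program \<Rightarrow> 'p psym \<Rightarrow> nat \<Rightarrow> bool" where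
  "bound_position L P p i \<longleftrightarrow>
     i \<in> positions L p Input \<and>
       (\<exists>(h, B)\<in>clauses P. psym h = p \<and> \<not> is_Var (args h ! i)) \<or>
     i \<in> positions L p Output \<and>
       (\<exists>(h, B)\<in>clauses P. \<exists>a\<in>set B. psym a = p \<and> \<not> is_Var (args a ! i))"

definition blocked :: "('f, 'p) program \<Rightarrow> ('f, 'p) atom \<Rightarrow> bool" where
  "blocked P a \<longleftrightarrow>
     (\<exists>b\<in>block P (psym a). \<forall>i<length b. b ! i = Dash \<longrightarrow> is_Var (args a ! i))"

abbreviation selectable :: "('f, 'p) program \<Rightarrow> ('f, 'p) atom \<Rightarrow> bool" where
  "selectable P a \<equiv> \<not> blocked P a"

definition input_selectability :: "('f, 'p) language \<Rightarrow> ('f, 'p) program \<Rightarrow> bool" where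
  "input_selectability L P \<longleftrightarrow>
     perm_simply_typed_program L P \<and>
     (\<forall>a. wf_atom L a \<and> psym a \<in> preds P \<and>
          (\<forall>i\<in>positions L (psym a) Output.
             \<not> bound_position L P (psym a) i \<longrightarrow> is_Var (args a ! i)) \<longrightarrow>
        (selectable P a \<longrightarrow>
          (\<forall>i\<in>positions L (psym a) Input.
             bound_position L P (psym a) i \<longrightarrow> \<not> is_Var (args a ! i))) \<and>
        ((\<forall>i\<in>positions L (psym a) Input.
             ptype L (psym a) ! i \<noteq> variable_type L \<longrightarrow> \<not> is_Var (args a ! i)) \<longrightarrow>
          selectable P a))"


section \<open>Derivations\<close>

fun is_variant :: "('f, 'p) clause \<Rightarrow> ('f, 'p) clause \<Rightarrow> bool" where
  "is_variant c' (h, B) \<longleftrightarrow>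
     (\<exists>\<rho>::nat \<Rightarrow> nat. bij \<rho> \<and> c' = (subst_atom (Var \<circ> \<rho>) h, subst_query (Var \<circ> \<rho>) B))"

definition unifier ::
  "('f, 'p) language \<Rightarrow> 'f subst \<Rightarrow> ('f, 'p) atom \<Rightarrow> ('f, 'p) atom \<Rightarrow> bool" where
  "unifier L \<theta> a b \<longleftrightarrow> wf_subst L \<theta> \<and> subst_atom \<theta> a = subst_atom \<theta> b"

definition is_mgu ::
  "('f, 'p) language \<Rightarrow> 'f subst \<Rightarrow> ('f, 'p) atom \<Rightarrow> ('f, 'p) atom \<Rightarrow> bool" where
  "is_mgu L \<theta> a b \<longleftrightarrow> unifier L \<theta> a b \<and>
     (\<forall>\<sigma>. unifier L \<sigma> a b \<longrightarrow>
        (\<exists>\<delta>. wf_subst L \<delta> \<and> (\<forall>x. \<sigma> x = subst_trm \<delta> (\<theta> x))))"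

definition non_speculative :: "('f, 'p) language \<Rightarrow> ('f, 'p) program \<Rightarrow> bool" where
  "non_speculative L P \<longleftrightarrow>
     perm_simply_typed_program L P \<and> input_linear_program L P \<and>
     (\<forall>a. wf_atom L a \<and> psym a \<in> preds P \<and> simply_typed_atom L a \<longrightarrow>
        (\<exists>c\<in>clauses P. \<exists>h B \<theta>. is_variant (h, B) c \<and>
           vars_query (h # B) \<inter> vars_atom a = {} \<and> unifier L \<theta> a h))"

text \<open>\<open>resolvent L P Q\<^sub>1 a Q\<^sub>2 R\<close>: one derivation step replaces the query \<open>Q\<^sub>1, a, Q\<^sub>2\<close>, with selected
  atom \<open>a\<close>, by \<open>R\<close>.\<close>

definition resolvent ::
  "('f, 'p) language \<Rightarrow> ('f, 'p) program \<Rightarrow>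
   ('f, 'p) query \<Rightarrow> ('f, 'p) atom \<Rightarrow> ('f, 'p) query \<Rightarrow> ('f, 'p) query \<Rightarrow> bool" where
  "resolvent L P Q\<^sub>1 a Q\<^sub>2 R \<longleftrightarrow>
     (\<exists>c\<in>clauses P. \<exists>h B \<theta>. is_variant (h, B) c \<and>
        vars_query (h # B) \<inter> vars_query (Q\<^sub>1 @ a # Q\<^sub>2) = {} \<and>
        is_mgu L \<theta> a h \<and> R = subst_query \<theta> (Q\<^sub>1 @ B @ Q\<^sub>2))"

definition LD_step ::
  "('f, 'p) language \<Rightarrow> ('f, 'p) program \<Rightarrow> ('f, 'p) query \<Rightarrow> ('f, 'p) query \<Rightarrow> bool" where
  "LD_step L P Q R \<longleftrightarrow> (\<exists>a Q\<^sub>2. Q = a # Q\<^sub>2 \<and> resolvent L P [] a Q\<^sub>2 R)"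

definition delay_respecting_step ::
  "('f, 'p) language \<Rightarrow> ('f, 'p) program \<Rightarrow> ('f, 'p) query \<Rightarrow> ('f, 'p) query \<Rightarrow> bool" where
  "delay_respecting_step L P Q R \<longleftrightarrow>
     (\<exists>Q\<^sub>1 a Q\<^sub>2. Q = Q\<^sub>1 @ a # Q\<^sub>2 \<and> selectable P a \<and> resolvent L P Q\<^sub>1 a Q\<^sub>2 R)"

definition infinite_derivation ::
  "(('f, 'p) query \<Rightarrow> ('f, 'p) query \<Rightarrow> bool) \<Rightarrow> ('f, 'p) query \<Rightarrow>
   (nat \<Rightarrow> ('f, 'p) query) \<Rightarrow> bool" where
  "infinite_derivation step Q \<xi> \<longleftrightarrow> \<xi> 0 = Q \<and> (\<forall>k. step (\<xi> k) (\<xi> (Suc k)))"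

end

theory Submission
  imports Defs
begin

text \<open>Reorder every query of the given derivation so that it becomes simply typed; the derivation
  then uses the clauses of \<open>P'\<close>.  By input selectability, linearity and flatness of head inputs, a
  selected atom has its inputs matched by those of the head, so that a step only instantiates the
  output variables of the selected atom.  Such a derivation can therefore be replayed on any simply
  typed instance of its query, in any context.  Hence from a simply typed query \<open>b, U\<close> with an
  infinite derivation there is a leftmost step to another such query: if \<open>b\<close> is resolved at some
  point of the derivation, then this resolution can be done first; if it never is, then \<open>U\<close> alone
  has an infinite derivation, and \<open>b\<close> can be resolved with the clause that non-speculativity
  provides.\<close>

section \<open>Substitutions\<close>

text \<open>The obstacle is that moving the resolution of \<open>b\<close> to the front changes
  every later query: a clause body stands in place of \<open>b\<close>, and the rest of the query is
  instantiated. The arguments therefore range over all left contexts and all instances at once.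
  Readiness keeps this class closed: an input that is non-variable wherever some head is
  non-variable stays so under instantiation, so a matching head continues to match. The effect of a
  replayed step is read off from the mgu property alone: the replayed step yields a unifier for the
  original step, and this unifier factors through the original mgu, so the new resolvent is again a
  context followed by an instance of the old resolvent. The unifiability demanded by
  non-speculativity serves only the leftmost atom that is never resolved; without it the
  LD-derivation could fail there while the other atoms run forever. Typing is carried along because
  it makes the leftmost atom ready and makes it an atom that non-speculativity speaks of.\<close>

definition subst_comp :: "'f subst \<Rightarrow> 'f subst \<Rightarrow> 'f subst" (infixl "\<odot>" 70) where
  "\<sigma> \<odot> \<tau> = (\<lambda>x. subst_trm \<sigma> (\<tau> x))"

lemma subst_trm_comp: "subst_trm (\<sigma> \<odot> \<tau>) t = subst_trm \<sigma> (subst_trm \<tau> t)"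
  by (induction t) (auto simp: subst_comp_def)

lemma map_subst_trm_comp:
  "map (subst_trm (\<sigma> \<odot> \<tau>)) ts = map (subst_trm \<sigma>) (map (subst_trm \<tau>) ts)"
  by (simp add: subst_trm_comp)

lemma subst_atom_comp: "subst_atom (\<sigma> \<odot> \<tau>) a = subst_atom \<sigma> (subst_atom \<tau> a)"
  by (simp add: subst_atom_def subst_trm_comp)

lemma subst_query_comp: "subst_query (\<sigma> \<odot> \<tau>) Q = subst_query \<sigma> (subst_query \<tau> Q)"
  by (simp add: subst_query_def subst_atom_comp)

lemma subst_query_simps [simp]:
  "subst_query \<sigma> [] = []"
  "subst_query \<sigma> (a # Q) = subst_atom \<sigma> a # subst_query \<sigma> Q"
  "subst_query \<sigma> (Q @ R) = subst_query \<sigma> Q @ subst_query \<sigma> R"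
  by (auto simp: subst_query_def)

lemma set_subst_query: "set (subst_query \<sigma> Q) = subst_atom \<sigma> ` set Q"
  by (simp add: subst_query_def)

lemma psym_subst_atom [simp]: "psym (subst_atom \<sigma> a) = psym a"
  by (simp add: subst_atom_def)

lemma args_subst_atom [simp]: "args (subst_atom \<sigma> a) = map (subst_trm \<sigma>) (args a)"
  by (simp add: subst_atom_def)

lemma subst_trm_Var [simp]: "subst_trm Var t = t"
  by (induction t) (auto simp: map_idI)

lemma map_subst_trm_Var [simp]: "map (subst_trm Var) ts = ts"
  by (simp add: map_idI)

lemma subst_atom_Var [simp]: "subst_atom Var a = a"
  by (cases a) (auto simp: subst_atom_def map_idI)

lemma subst_query_Var [simp]: "subst_query Var Q = Q"
  by (simp add: subst_query_def map_idI)

lemma subst_trm_cong: "(\<And>x. x \<in> set (occs t) \<Longrightarrow> \<sigma> x = \<tau> x) \<Longrightarrow> subst_trm \<sigma> t = subst_trm \<tau> t"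
  by (induction t) auto

lemma subst_trm_eqD: "subst_trm \<sigma> t = subst_trm \<tau> t \<Longrightarrow> x \<in> set (occs t) \<Longrightarrow> \<sigma> x = \<tau> x"
  by (induction t) auto

lemma vars_list_simps [simp]:
  "vars_list [] = {}"
  "vars_list (t # ts) = set (occs t) \<union> vars_list ts"
  "vars_list (ts @ us) = vars_list ts \<union> vars_list us"
  by (auto simp: vars_list_def occs_list_def)

lemma vars_list_eq: "vars_list ts = (\<Union>t\<in>set ts. set (occs t))"
  by (auto simp: vars_list_def occs_list_def)

lemma vars_query_simps [simp]:
  "vars_query [] = {}"
  "vars_query (a # Q) = vars_atom a \<union> vars_query Q"
  "vars_query (Q @ R) = vars_query Q \<union> vars_query R"
  by (auto simp: vars_query_def)

lemma map_subst_trm_cong: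
  "(\<And>x. x \<in> vars_list ts \<Longrightarrow> \<sigma> x = \<tau> x) \<Longrightarrow> map (subst_trm \<sigma>) ts = map (subst_trm \<tau>) ts"
  by (auto simp: vars_list_eq intro!: subst_trm_cong)

lemma map_subst_trm_eqD:
  "map (subst_trm \<sigma>) ts = map (subst_trm \<tau>) ts \<Longrightarrow> x \<in> vars_list ts \<Longrightarrow> \<sigma> x = \<tau> x"
  by (auto simp: vars_list_eq dest: subst_trm_eqD)

lemma subst_atom_cong:
  "(\<And>x. x \<in> vars_atom a \<Longrightarrow> \<sigma> x = \<tau> x) \<Longrightarrow> subst_atom \<sigma> a = subst_atom \<tau> a"
  unfolding subst_atom_def vars_atom_def using map_subst_trm_cong[of "args a" \<sigma> \<tau>] by simp

lemma subst_query_cong: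
  "(\<And>x. x \<in> vars_query Q \<Longrightarrow> \<sigma> x = \<tau> x) \<Longrightarrow> subst_query \<sigma> Q = subst_query \<tau> Q"
  unfolding subst_query_def vars_query_def by (auto intro!: subst_atom_cong)

lemma occs_subst_trm: "occs (subst_trm \<sigma> t) = concat (map (\<lambda>x. occs (\<sigma> x)) (occs t))"
proof (induction t)
  case (Fun f ts)
  then have "map (occs \<circ> subst_trm \<sigma>) ts = map ((\<lambda>xs. concat (map (\<lambda>x. occs (\<sigma> x)) xs)) \<circ> occs) ts"
    by auto
  then show ?case
    by (induction ts) auto
qed simp

lemma vars_list_subst:
  "vars_list (map (subst_trm \<sigma>) ts) = (\<Union>x\<in>vars_list ts. set (occs (\<sigma> x)))"
  by (auto simp: vars_list_eq occs_subst_trm)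

lemma finite_vars_query: "finite (vars_query Q)"
  by (auto simp: vars_query_def vars_atom_def vars_list_eq)

lemma wf_trm_subst: "wf_subst L \<sigma> \<Longrightarrow> wf_trm L t \<Longrightarrow> wf_trm L (subst_trm \<sigma> t)"
  by (induction t) (auto simp: wf_subst_def list_all_iff)

lemma wf_subst_comp: "wf_subst L \<sigma> \<Longrightarrow> wf_subst L \<tau> \<Longrightarrow> wf_subst L (\<sigma> \<odot> \<tau>)"
  unfolding wf_subst_def[of L "\<sigma> \<odot> \<tau>"] by (simp add: subst_comp_def wf_trm_subst wf_subst_def[of L \<tau>])

lemma wf_subst_Var [simp]: "wf_subst L Var" "wf_subst L (Var \<circ> \<rho>)"
  by (auto simp: wf_subst_def)

lemma wf_atom_subst: "wf_subst L \<sigma> \<Longrightarrow> wf_atom L a \<Longrightarrow> wf_atom L (subst_atom \<sigma> a)"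
  by (auto simp: wf_atom_def wf_trm_subst)

lemma is_Var_substD: "is_Var (subst_trm \<sigma> t) \<Longrightarrow> is_Var t"
  by (cases t) auto


section \<open>Input and output vectors\<close>

lemma ins_subst [simp]: "ins L (subst_atom \<sigma> a) = map (subst_trm \<sigma>) (ins L a)"
  by (simp add: ins_def nths_map)

lemma outs_subst [simp]: "outs L (subst_atom \<sigma> a) = map (subst_trm \<sigma>) (outs L a)"
  by (simp add: outs_def nths_map)

text \<open>\<open>nths\<close> with the same index set picks the same positions from lists of equal
  length. The relation is left general: equality compares input and output vectors, and the relation
  "is matched by" serves for head inputs.\<close>

lemma list_all2_nths:
  "length xs = length ys \<Longrightarrow>
    list_all2 R (nths xs A) (nths ys A) \<longleftrightarrow> (\<forall>i\<in>A. i < length xs \<longrightarrow> R (xs ! i) (ys ! i))"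
proof (induction xs arbitrary: ys A)
  case (Cons x xs)
  then obtain y ys' where ys: "ys = y # ys'" "length xs = length ys'"
    by (cases ys) auto
  have IH: "list_all2 R (nths xs {j. Suc j \<in> A}) (nths ys' {j. Suc j \<in> A}) \<longleftrightarrow>
      (\<forall>i\<in>{j. Suc j \<in> A}. i < length xs \<longrightarrow> R (xs ! i) (ys' ! i))"
    by (rule Cons.IH[OF ys(2)])
  have "(\<forall>i\<in>A. i < Suc (length xs) \<longrightarrow> R ((x # xs) ! i) ((y # ys') ! i)) \<longleftrightarrow>
      (0 \<in> A \<longrightarrow> R x y) \<and> (\<forall>i\<in>{j. Suc j \<in> A}. i < length xs \<longrightarrow> R (xs ! i) (ys' ! i))"
    (is "?l = ?r")
  proof
    assume ?r
    show ?l
    proof (intro ballI impI)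
      fix i assume "i \<in> A" "i < Suc (length xs)"
      then show "R ((x # xs) ! i) ((y # ys') ! i)" using \<open>?r\<close> by (cases i) auto
    qed
  next
    assume l: ?l
    show ?r
      using bspec[OF l, of 0] bspec[OF l, of "Suc _"] by auto
  qed
  then show ?case
    unfolding ys(1) nths_Cons length_Cons using IH by auto
qed simp

lemma nths_eq_iff:
  "length xs = length ys \<Longrightarrow> nths xs A = nths ys A \<longleftrightarrow> (\<forall>i\<in>A. i < length xs \<longrightarrow> xs ! i = ys ! i)"
  using list_all2_nths[of xs ys "(=)" A] by (simp add: list.rel_eq)

lemma ins_eq_iff:
  assumes "length (args a) = length (mode L (psym a))" "length (args b) = length (args a)"
    "psym b = psym a"
  shows "ins L a = ins L b \<longleftrightarrow> (\<forall>i\<in>positions L (psym a) Input. args a ! i = args b ! i)"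
  using assms by (auto simp: ins_def nths_eq_iff positions_def)

lemma outs_eq_iff:
  assumes "length (args a) = length (mode L (psym a))" "length (args b) = length (args a)"
    "psym b = psym a"
  shows "outs L a = outs L b \<longleftrightarrow> (\<forall>i\<in>positions L (psym a) Output. args a ! i = args b ! i)"
  using assms by (auto simp: outs_def nths_eq_iff positions_def)

lemma atom_eqI:
  assumes "wf_atom L a" "wf_atom L b" "psym b = psym a"
    and "ins L a = ins L b" "outs L a = outs L b"
  shows "a = b"
proof (rule atom.expand, intro conjI)
  have len: "length (args a) = length (mode L (psym a))" "length (args b) = length (args a)"
    using assms by (auto simp: wf_atom_def)
  show "args a = args b"
  proof (rule nth_equalityI)
    fix i assume "i < length (args a)"
    then have "i \<in> positions L (psym a) Input \<or> i \<in> positions L (psym a) Output"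
      using len mode.exhaust[of "mode L (psym a) ! i"] by (auto simp: positions_def)
    then show "args a ! i = args b ! i"
      using assms(4,5) ins_eq_iff[OF len assms(3)] outs_eq_iff[OF len assms(3)] by blast
  qed (use len in simp)
qed (use assms in simp)

lemma set_ins:
  "length (args a) = length (mode L (psym a)) \<Longrightarrow>
    set (ins L a) = (\<lambda>i. args a ! i) ` positions L (psym a) Input"
  by (auto simp: ins_def set_nths positions_def)

lemma set_outs:
  "length (args a) = length (mode L (psym a)) \<Longrightarrow>
    set (outs L a) = (\<lambda>i. args a ! i) ` positions L (psym a) Output"
  by (auto simp: outs_def set_nths positions_def)

lemma vars_ins_outs:
  assumes "wf_atom L a"
  shows "vars_atom a = vars_list (ins L a) \<union> vars_list (outs L a)"
proof -
  have len: "length (args a) = length (mode L (psym a))"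
    using assms by (simp add: wf_atom_def)
  then have "{..<length (args a)} = positions L (psym a) Input \<union> positions L (psym a) Output"
    using mode.exhaust by (auto simp: positions_def)
  then have "set (args a) = set (ins L a) \<union> set (outs L a)"
    using len unfolding set_ins[OF len] set_outs[OF len] by (simp flip: image_Un add: set_conv_nth) auto
  then show ?thesis
    by (auto simp: vars_atom_def vars_list_eq)
qed

lemma length_outs:
  assumes "wf_atom L a" "wf_atom L b" "psym a = psym b"
  shows "length (outs L a) = length (outs L b)"
  using assms by (simp add: outs_def length_nths wf_atom_def)

lemma wf_outs: "wf_atom L a \<Longrightarrow> t \<in> set (outs L a) \<Longrightarrow> wf_trm L t"
  by (auto simp: wf_atom_def outs_def dest: in_set_nthsD)


section \<open>Matching and unification\<close>

lemma linear_Cons: "linear (t # ts) \<longleftrightarrow>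
    distinct (occs t) \<and> linear ts \<and> set (occs t) \<inter> vars_list ts = {}"
  by (auto simp: linear_def vars_list_def occs_list_def)

text \<open>Linearity makes the matchers of the single terms act on disjoint sets of variables, so
  they can be glued together.\<close>

lemma joint_matcher:
  assumes "list_all2 (\<lambda>t s. \<exists>\<sigma>. wf_subst L \<sigma> \<and> subst_trm \<sigma> t = s) ts ss" and "linear ts"
  shows "\<exists>\<sigma>. wf_subst L \<sigma> \<and> map (subst_trm \<sigma>) ts = ss"
  using assms
proof (induction rule: list_all2_induct)
  case Nil
  show ?case by (auto intro: wf_subst_Var)
next
  case (Cons t ts s ss)
  then obtain \<sigma> \<tau> where \<sigma>: "wf_subst L \<sigma>" "subst_trm \<sigma> t = s"
    and \<tau>: "wf_subst L \<tau>" "map (subst_trm \<tau>) ts = ss"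
    by (auto simp: linear_Cons)
  let ?\<mu> = "\<lambda>x. if x \<in> set (occs t) then \<sigma> x else \<tau> x"
  have "subst_trm ?\<mu> t = subst_trm \<sigma> t"
    by (rule subst_trm_cong) simp
  moreover have "map (subst_trm ?\<mu>) ts = map (subst_trm \<tau>) ts"
    using Cons.prems by (intro map_subst_trm_cong) (auto simp: linear_Cons)
  moreover have "wf_subst L ?\<mu>"
    using \<sigma> \<tau> by (simp add: wf_subst_def)
  ultimately show ?case
    using \<sigma> \<tau> by auto
qed

lemma linear_map_Var: "linear (map Var xs) \<longleftrightarrow> distinct xs"
  by (simp add: linear_def occs_list_def comp_def)

text \<open>A variable matches everything. If \<open>t\<close> is a function term, then so is
  \<open>s\<close>, unifiability forces the same symbol and arity, and the arguments of
  \<open>t\<close> are distinct variables that can be bound independently.\<close>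

lemma flat_matcher:
  assumes "flat t" "wf_trm L s" "\<not> is_Var t \<Longrightarrow> \<not> is_Var s" "subst_trm \<sigma> s = subst_trm \<tau> t"
  shows "\<exists>\<mu>. wf_subst L \<mu> \<and> subst_trm \<mu> t = s"
proof (cases t)
  case (Var x)
  then show ?thesis
    using assms(2) by (intro exI[of _ "\<lambda>_. s"]) (simp add: wf_subst_def)
next
  case (Fun f ts)
  then obtain xs where xs: "ts = map Var xs" "distinct xs"
    using assms(1) by (auto simp: flat_def)
  obtain ss where s: "s = Fun f ss" and eq: "map (subst_trm \<sigma>) ss = map (subst_trm \<tau>) ts"
    using assms(3,4) Fun by (cases s) auto
  have len: "length ss = length ts"
    using arg_cong[OF eq, of length] by simp
  have "list_all2 (\<lambda>t s. \<exists>\<sigma>. wf_subst L \<sigma> \<and> subst_trm \<sigma> t = s) ts ss"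
  proof (rule list_all2_all_nthI)
    fix i assume i: "i < length ts"
    have "wf_trm L (ss ! i)"
      using assms(2) s i len by (simp add: list_all_length)
    then have "wf_subst L (\<lambda>_. ss ! i) \<and> subst_trm (\<lambda>_. ss ! i) (ts ! i) = ss ! i"
      using xs i by (simp add: wf_subst_def)
    then show "\<exists>\<sigma>. wf_subst L \<sigma> \<and> subst_trm \<sigma> (ts ! i) = ss ! i"
      by blast
  qed (simp add: len)
  then obtain \<mu> where "wf_subst L \<mu>" "map (subst_trm \<mu>) ts = ss"
    using joint_matcher[of L ts ss] linear_map_Var[of xs] xs by auto
  then show ?thesis
    using Fun s by auto
qed

text \<open>This is where two-way unification becomes one-way matching. The two substitutions
  \<open>\<sigma>\<close> and \<open>\<tau>\<close> allow \<open>a\<close> and \<open>h\<close> to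
  share variables, so the lemma applies to original clauses as well as to variants.\<close>

lemma matcher_ex:
  assumes a: "wf_atom L a" and h: "wf_atom L h" and eq: "subst_atom \<sigma> a = subst_atom \<tau> h"
    and lin: "linear (ins L h)" and flat: "\<And>i. i \<in> positions L (psym h) Input \<Longrightarrow> flat (args h ! i)"
    and nonvar: "\<And>i. i \<in> positions L (psym h) Input \<Longrightarrow> \<not> is_Var (args h ! i) \<Longrightarrow> \<not> is_Var (args a ! i)"
  shows "\<exists>\<mu>. wf_subst L \<mu> \<and> map (subst_trm \<mu>) (ins L h) = ins L a"
proof -
  have p: "psym a = psym h"
    using eq psym_subst_atom by metis
  have len: "length (args a) = length (mode L (psym a))" "length (args h) = length (args a)"
    using a h p by (auto simp: wf_atom_def)
  have "\<exists>\<mu>. wf_subst L \<mu> \<and> subst_trm \<mu> (args h ! i) = args a ! i"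
    if i: "i \<in> positions L (psym h) Input" for i
  proof (rule flat_matcher)
    have "i < length (args a)"
      using i len p by (simp add: positions_def)
    then show "wf_trm L (args a ! i)"
      using a by (simp add: wf_atom_def)
    show "subst_trm \<sigma> (args a ! i) = subst_trm \<tau> (args h ! i)"
      using arg_cong[OF eq, of "\<lambda>b. args b ! i"] \<open>i < length (args a)\<close> len by simp
  qed (use i flat nonvar in auto)
  then have "list_all2 (\<lambda>t s. \<exists>\<mu>. wf_subst L \<mu> \<and> subst_trm \<mu> t = s) (ins L h) (ins L a)"
    unfolding ins_def p using len by (subst list_all2_nths) auto
  then show ?thesis
    using joint_matcher lin by blast
qed

text \<open>Once the head inputs match, unification only has to bind the output variables of
  \<open>a\<close> to the output terms of the head. The last three conclusions record which
  variables move and where; preservation of modes rests on them.\<close>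

lemma matching_mgu:
  assumes a: "wf_atom L a" and h: "wf_atom L h" and p: "psym h = psym a"
    and outs: "outs L a = map Var ys" and ys: "distinct ys" "vars_list (ins L a) \<inter> set ys = {}"
    and apart: "vars_atom h \<inter> vars_atom a = {}"
    and \<mu>: "wf_subst L \<mu>" "map (subst_trm \<mu>) (ins L h) = ins L a"
  obtains \<theta> where "is_mgu L \<theta> a h"
    and "\<And>x. x \<notin> vars_list (ins L h) \<Longrightarrow> x \<notin> vars_list (outs L a) \<Longrightarrow> \<theta> x = Var x"
    and "\<And>x. x \<in> vars_list (ins L h) \<Longrightarrow> set (occs (\<theta> x)) \<subseteq> vars_list (ins L a)"
    and "\<And>x. x \<in> vars_list (outs L a) \<Longrightarrow> set (occs (\<theta> x)) \<subseteq> vars_list (ins L a) \<union> vars_atom h"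
proof -
  \<comment> \<open>Restricting the matcher to the variables of the head inputs leaves all other
    clause variables fixed. The distinctness of \<open>ys\<close> makes the next line, which sends
    each output variable of \<open>a\<close> to the matched head output, a consistent
    assignment.\<close>
  define \<mu>' where "\<mu>' = (\<lambda>x. if x \<in> vars_list (ins L h) then \<mu> x else Var x)"
  define m where "m = map_of (zip ys (map (subst_trm \<mu>') (outs L h)))"
  define \<theta> where "\<theta> = (\<lambda>x. case m x of Some t \<Rightarrow> t | None \<Rightarrow> \<mu>' x)"
  have vh: "vars_atom h = vars_list (ins L h) \<union> vars_list (outs L h)"
    and va: "vars_atom a = vars_list (ins L a) \<union> set ys"
    using vars_ins_outs[OF h] vars_ins_outs[OF a] outs by (auto simp: vars_list_eq)
  have len: "length ys = length (outs L h)"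
    using length_outs[OF a h p[symmetric]] outs by simp
  have dom: "dom m = set ys"
    unfolding m_def using len by simp
  have \<theta>_out: "\<theta> x = \<mu>' x" if "x \<notin> set ys" for x
    using that dom by (auto simp: \<theta>_def split: option.split)
  have \<theta>_ys: "map (subst_trm \<theta>) (map Var ys) = map (subst_trm \<mu>') (outs L h)"
    using len ys(1) by (auto simp: list_eq_iff_nth_eq \<theta>_def m_def map_of_zip_nth)
  have wf_\<mu>': "wf_subst L \<mu>'"
    using \<mu> by (simp add: wf_subst_def \<mu>'_def)
  have m_Some: "\<exists>u\<in>set (outs L h). t = subst_trm \<mu>' u" if "m x = Some t" for x t
    using map_of_SomeD[OF that[unfolded m_def]] by (auto dest!: set_zip_rightD)
  have wf_\<theta>: "wf_subst L \<theta>"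
    unfolding wf_subst_def
  proof
    fix x show "wf_trm L (\<theta> x)"
      using wf_\<mu>' m_Some[of x] wf_outs[OF h] wf_trm_subst[OF wf_\<mu>']
      by (auto simp: \<theta>_def wf_subst_def split: option.split)
  qed
  have ins_h: "map (subst_trm \<mu>') (ins L h) = ins L a"
    unfolding \<mu>(2)[symmetric] by (rule map_subst_trm_cong) (simp add: \<mu>'_def)
  have "map (subst_trm \<theta>) (ins L h) = map (subst_trm \<mu>') (ins L h)"
    using apart vh va by (intro map_subst_trm_cong \<theta>_out) auto
  moreover have "\<theta> x = Var x" if "x \<in> vars_list (ins L a)" for x
  proof -
    have "x \<notin> set ys" "x \<notin> vars_list (ins L h)"
      using that apart ys(2) vh va by auto
    then show ?thesis by (simp add: \<theta>_out \<mu>'_def)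
  qed
  then have "map (subst_trm \<theta>) (ins L a) = map (subst_trm Var) (ins L a)"
    by (rule map_subst_trm_cong)
  ultimately have ins: "map (subst_trm \<theta>) (ins L h) = map (subst_trm \<theta>) (ins L a)"
    using ins_h by simp
  have outs_h: "map (subst_trm \<theta>) (outs L h) = map (subst_trm \<mu>') (outs L h)"
    using apart vh va by (intro map_subst_trm_cong \<theta>_out) auto
  have "subst_atom \<theta> a = subst_atom \<theta> h"
  proof (rule atom_eqI)
    show "wf_atom L (subst_atom \<theta> a)" "wf_atom L (subst_atom \<theta> h)"
      using a h wf_\<theta> by (simp_all add: wf_atom_subst)
    show "ins L (subst_atom \<theta> a) = ins L (subst_atom \<theta> h)"
      unfolding ins_subst by (rule ins[symmetric])
    show "outs L (subst_atom \<theta> a) = outs L (subst_atom \<theta> h)"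
      unfolding outs_subst outs outs_h by (rule \<theta>_ys)
  qed (simp add: p)
  moreover have "\<sigma> x = subst_trm \<sigma> (\<theta> x)" if u: "unifier L \<sigma> a h" for \<sigma> x
  proof -
    have eq: "subst_atom \<sigma> a = subst_atom \<sigma> h"
      using u by (simp add: unifier_def)
    \<comment> \<open>Both sides are the inputs of \<open>a\<close> under \<open>\<sigma>\<close>:
      the left because \<open>\<sigma>\<close> unifies, the right because \<open>\<mu>\<close>
      matches. Hence any unifier absorbs \<open>\<mu>'\<close>, which gives most generality.\<close>
    have "map (subst_trm \<sigma>) (ins L h) = map (subst_trm (\<sigma> \<odot> \<mu>)) (ins L h)"
      unfolding map_subst_trm_comp \<mu>(2) using arg_cong[OF eq, of "ins L"] by simp
    then have \<mu>x: "subst_trm \<sigma> (\<mu>' z) = \<sigma> z" for z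
      using map_subst_trm_eqD[of \<sigma> _ "\<sigma> \<odot> \<mu>" z] by (auto simp: \<mu>'_def subst_comp_def)
    show ?thesis
    proof (cases "x \<in> set ys")
      case True
      have "\<sigma> \<odot> \<mu>' = \<sigma>"
        using \<mu>x by (simp add: subst_comp_def)
      then have "map (subst_trm \<sigma>) (outs L h) = map (subst_trm \<sigma>) (map (subst_trm \<mu>') (outs L h))"
        using map_subst_trm_comp[of \<sigma> \<mu>'] by simp
      then have "map (subst_trm \<sigma>) (map Var ys) = map (subst_trm (\<sigma> \<odot> \<theta>)) (map Var ys)"
        unfolding map_subst_trm_comp \<theta>_ys using arg_cong[OF eq, of "outs L"] outs by simp
      then show ?thesis
        using map_subst_trm_eqD[of \<sigma> "map Var ys" "\<sigma> \<odot> \<theta>" x] True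
        by (auto simp: vars_list_eq subst_comp_def)
    next
      case False
      then show ?thesis
        using \<theta>_out \<mu>x by simp
    qed
  qed
  ultimately have mgu: "is_mgu L \<theta> a h"
    using wf_\<theta> unfolding is_mgu_def unifier_def by blast
  have yso: "vars_list (outs L a) = set ys"
    using outs by (auto simp: vars_list_eq)
  have fixed: "\<theta> x = Var x" if "x \<notin> vars_list (ins L h)" "x \<notin> vars_list (outs L a)" for x
    using that \<theta>_out yso by (simp add: \<mu>'_def)
  have \<mu>_vars: "set (occs (\<mu>' x)) \<subseteq> vars_list (ins L a)" if "x \<in> vars_list (ins L h)" for x
    using that vars_list_subst[of \<mu>' "ins L h"] ins_h by auto
  have ins_vars: "set (occs (\<theta> x)) \<subseteq> vars_list (ins L a)" if x: "x \<in> vars_list (ins L h)" for x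
  proof -
    have "x \<notin> set ys"
      using x apart vh va by auto
    then show ?thesis
      using \<mu>_vars[OF x] \<theta>_out by simp
  qed
  have outs_vars: "set (occs (\<theta> x)) \<subseteq> vars_list (ins L a) \<union> vars_atom h"
    if x: "x \<in> vars_list (outs L a)" for x
  proof -
    have "set (occs (\<theta> x)) \<subseteq> vars_list (map (subst_trm \<theta>) (map Var ys))"
      using x yso by (auto simp: vars_list_eq)
    also have "\<dots> = (\<Union>z\<in>vars_list (outs L h). set (occs (\<mu>' z)))"
      unfolding \<theta>_ys vars_list_subst ..
    also have "\<dots> \<subseteq> vars_list (ins L a) \<union> vars_atom h"
    proof (rule UN_least)
      fix z assume "z \<in> vars_list (outs L h)"
      then show "set (occs (\<mu>' z)) \<subseteq> vars_list (ins L a) \<union> vars_atom h"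
        using \<mu>_vars[of z] vh by (cases "z \<in> vars_list (ins L h)") (auto simp: \<mu>'_def)
    qed
    finally show ?thesis .
  qed
  show thesis
    by (rule that[OF mgu fixed ins_vars outs_vars])
qed


lemma matcher_variant:
  assumes "bij \<rho>" and "map (subst_trm \<mu>) (ins L h) = ts" and "wf_subst L \<mu>"
  obtains \<mu>' where "wf_subst L \<mu>'" "map (subst_trm \<mu>') (ins L (subst_atom (Var \<circ> \<rho>) h)) = ts"
proof
  have "(\<mu> \<circ> inv \<rho>) \<odot> (Var \<circ> \<rho>) = \<mu>"
    using assms(1) by (auto simp: subst_comp_def bij_is_inj)
  then show "map (subst_trm (\<mu> \<circ> inv \<rho>)) (ins L (subst_atom (Var \<circ> \<rho>) h)) = ts"
    using assms(2) map_subst_trm_comp[of "\<mu> \<circ> inv \<rho>" "Var \<circ> \<rho>" "ins L h"] by simp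
  show "wf_subst L (\<mu> \<circ> inv \<rho>)"
    using assms(3) by (simp add: wf_subst_def)
qed


section \<open>Simply typed queries and clauses\<close>

text \<open>Repetitions are kept, so that \<open>distinct\<close> expresses linearity of the joint
  output vector.\<close>

definition outvars :: "('f, 'p) language \<Rightarrow> ('f, 'p) query \<Rightarrow> nat list" where
  "outvars L Q = occs_list (concat (map (outs L) Q))"

lemma outvars_simps [simp]:
  "outvars L [] = []"
  "outvars L (a # Q) = occs_list (outs L a) @ outvars L Q"
  "outvars L (Q @ R) = outvars L Q @ outvars L R"
  by (auto simp: outvars_def occs_list_def)

lemma set_outvars: "set (outvars L Q) = (\<Union>a\<in>set Q. vars_list (outs L a))"
  by (induction Q) (auto simp: vars_list_def)

text \<open>The disjointness condition of nicely moded queries for the identity permutation.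
  Recursion on the list, in place of quantified positions, lets a query be split at the selected
  atom.\<close>

primrec left_moded :: "('f, 'p) language \<Rightarrow> ('f, 'p) query \<Rightarrow> bool" where
  "left_moded L [] \<longleftrightarrow> True"
| "left_moded L (a # Q) \<longleftrightarrow>
     vars_list (ins L a) \<inter> set (outvars L (a # Q)) = {} \<and> left_moded L Q"

text \<open>\<open>G\<close> is the assumption on instances contributed by whatever stands to the left of the
  query.\<close>

primrec left_typed ::
  "('f, 'p) language \<Rightarrow> ('f, 'p) query \<Rightarrow> ('f subst \<Rightarrow> bool) \<Rightarrow> bool" where
  "left_typed L [] G \<longleftrightarrow> True"
| "left_typed L (a # Q) G \<longleftrightarrow>
     (\<forall>\<sigma>. wf_subst L \<sigma> \<longrightarrow> G \<sigma> \<longrightarrow> ins_typed L (subst_atom \<sigma> a)) \<and>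
     left_typed L Q (\<lambda>\<sigma>. G \<sigma> \<and> outs_typed L (subst_atom \<sigma> a))"

definition simply_moded :: "('f, 'p) language \<Rightarrow> ('f, 'p) query \<Rightarrow> bool" where
  "simply_moded L Q \<longleftrightarrow>
     (\<forall>a\<in>set Q. wf_atom L a \<and> (\<forall>t\<in>set (outs L a). is_Var t)) \<and>
     distinct (outvars L Q) \<and> left_moded L Q"

definition simply_typed :: "('f, 'p) language \<Rightarrow> ('f, 'p) query \<Rightarrow> bool" where
  "simply_typed L Q \<longleftrightarrow> simply_moded L Q \<and> left_typed L Q (\<lambda>_. True)"

definition moded_clause :: "('f, 'p) language \<Rightarrow> ('f, 'p) atom \<Rightarrow> ('f, 'p) query \<Rightarrow> bool" where
  "moded_clause L h B \<longleftrightarrow>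
     wf_atom L h \<and> simply_moded L B \<and> vars_list (ins L h) \<inter> set (outvars L B) = {}"

text \<open>The first conjunct covers the positions \<open>1, ..., n\<close> of well-typedness in
  the identity order, the second the position \<open>n + 1\<close>, the head outputs.\<close>

definition typed_clause :: "('f, 'p) language \<Rightarrow> ('f, 'p) atom \<Rightarrow> ('f, 'p) query \<Rightarrow> bool" where
  "typed_clause L h B \<longleftrightarrow>
     left_typed L B (\<lambda>\<sigma>. ins_typed L (subst_atom \<sigma> h)) \<and>
     (\<forall>\<sigma>. wf_subst L \<sigma> \<longrightarrow> ins_typed L (subst_atom \<sigma> h) \<longrightarrow>
        (\<forall>b\<in>set B. outs_typed L (subst_atom \<sigma> b)) \<longrightarrow> outs_typed L (subst_atom \<sigma> h))"

lemma left_moded_append: "left_moded L (Q @ R) \<longleftrightarrow> left_moded L Q \<and> left_moded L R \<and>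
    (\<forall>a\<in>set Q. vars_list (ins L a) \<inter> set (outvars L R) = {})"
  by (induction Q) auto

lemma left_typed_append: "left_typed L (Q @ R) G \<longleftrightarrow> left_typed L Q G \<and>
    left_typed L R (\<lambda>\<sigma>. G \<sigma> \<and> (\<forall>a\<in>set Q. outs_typed L (subst_atom \<sigma> a)))"
  by (induction Q arbitrary: G) (auto simp: conj_assoc)

text \<open>Typing quantifies over all substitutions, hence covers those of the form
  \<open>\<sigma> \<odot> \<theta>\<close>; only the guard has to be translated.\<close>

lemma left_typed_subst:
  assumes "left_typed L Q G" "wf_subst L \<theta>" "\<And>\<sigma>. wf_subst L \<sigma> \<Longrightarrow> G' \<sigma> \<Longrightarrow> G (\<sigma> \<odot> \<theta>)"
  shows "left_typed L (subst_query \<theta> Q) G'"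
  using assms
proof (induction Q arbitrary: G G')
  case (Cons a Q)
  have "ins_typed L (subst_atom \<sigma> (subst_atom \<theta> a))" if "wf_subst L \<sigma>" "G' \<sigma>" for \<sigma>
    using Cons.prems(1) Cons.prems(3)[OF that] wf_subst_comp[OF that(1) Cons.prems(2)]
    by (simp flip: subst_atom_comp)
  moreover have "left_typed L (subst_query \<theta> Q)
      (\<lambda>\<sigma>. G' \<sigma> \<and> outs_typed L (subst_atom \<sigma> (subst_atom \<theta> a)))"
    using Cons.prems(1,3)
    by (intro Cons.IH[of "\<lambda>\<sigma>. G \<sigma> \<and> outs_typed L (subst_atom \<sigma> a)", OF _ Cons.prems(2)])
      (auto simp: subst_atom_comp)
  ultimately show ?case
    by simp
qed simp

lemma occs_list_map_Var: "\<forall>t\<in>set ts. is_Var t \<Longrightarrow> ts = map Var (occs_list ts)"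
proof (induction ts)
  case (Cons t ts)
  then show ?case by (cases t) (auto simp: occs_list_def)
qed (simp add: occs_list_def)

text \<open>\<open>V\<close> collects the variables that \<open>\<theta>\<close> may bring into
  input positions. Keeping it away from the output variables, which \<open>\<theta>\<close> fixes,
  means that no new dependency on an output can arise.\<close>

lemma left_moded_subst:
  assumes "left_moded L Q" "\<And>x. x \<in> set (outvars L Q) \<Longrightarrow> \<theta> x = Var x"
    and "\<And>a x. a \<in> set Q \<Longrightarrow> x \<in> vars_list (ins L a) \<Longrightarrow> set (occs (\<theta> x)) \<subseteq> insert x V"
    and "V \<inter> set (outvars L Q) = {}"
  shows "left_moded L (subst_query \<theta> Q) \<and> outvars L (subst_query \<theta> Q) = outvars L Q"
  using assms
proof (induction Q)
  case (Cons a Q)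
  have IH: "left_moded L (subst_query \<theta> Q) \<and> outvars L (subst_query \<theta> Q) = outvars L Q"
  proof (rule Cons.IH)
    show "set (occs (\<theta> x)) \<subseteq> insert x V" if "b \<in> set Q" "x \<in> vars_list (ins L b)" for b x
      by (rule Cons.prems(3)[OF _ that(2)]) (simp add: that)
  qed (use Cons.prems in auto)
  have "map (subst_trm \<theta>) (outs L a) = map (subst_trm Var) (outs L a)"
    using Cons.prems(2) by (intro map_subst_trm_cong) (simp add: vars_list_def)
  then have eq: "map (subst_trm \<theta>) (outs L a) = outs L a"
    by simp
  have "vars_list (map (subst_trm \<theta>) (ins L a)) \<subseteq> vars_list (ins L a) \<union> V"
    unfolding vars_list_subst using Cons.prems(3)[of a] by (simp, blast)
  then have "vars_list (map (subst_trm \<theta>) (ins L a)) \<inter> set (outvars L (a # Q)) = {}"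
    using Cons.prems(1,4) by (simp, blast)
  then show ?case
    using IH eq by simp
qed simp

lemma subst_query_eqD:
  assumes "subst_query \<sigma> Q = subst_query \<tau> Q" "x \<in> vars_query Q"
  shows "\<sigma> x = \<tau> x"
proof -
  obtain a where a: "a \<in> set Q" "x \<in> vars_list (args a)"
    using assms(2) by (auto simp: vars_query_def vars_atom_def)
  have "subst_atom \<sigma> a = subst_atom \<tau> a"
    using assms(1) a(1) by (simp add: subst_query_def)
  then have "map (subst_trm \<sigma>) (args a) = map (subst_trm \<tau>) (args a)"
    by (simp add: subst_atom_def)
  then show ?thesis
    using a(2) by (rule map_subst_trm_eqD)
qed

section \<open>Invariance under renaming of variables\<close>

lemma occs_list_rename:
  assumes "\<And>x. x \<in> vars_list ts \<Longrightarrow> \<delta> x = Var (r x)"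
  shows "occs_list (map (subst_trm \<delta>) ts) = map r (occs_list ts)"
  using assms
proof (induction ts)
  case (Cons t ts)
  have "occs (subst_trm \<delta> t) = concat (map (\<lambda>x. [r x]) (occs t))"
    unfolding occs_subst_trm using Cons.prems by (intro arg_cong[of _ _ concat] map_cong) auto
  moreover have "occs_list (map (subst_trm \<delta>) ts) = map r (occs_list ts)"
    using Cons.prems by (intro Cons.IH) simp
  ultimately show ?case
    by (simp add: occs_list_def)
qed (simp add: occs_list_def)

text \<open>\<open>\<delta>\<close> has to act as an injective renaming only on the variables of
  \<open>Q\<close>. This covers both the renaming of clauses and the passage between two mgus, where
  nothing is known about \<open>\<delta>\<close> elsewhere.\<close>

lemma simply_moded_rename:
  assumes "simply_moded L Q" "wf_subst L \<delta>"
    and "\<And>x. x \<in> vars_query Q \<Longrightarrow> \<delta> x = Var (r x)" "inj_on r (vars_query Q)"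
  shows "simply_moded L (subst_query \<delta> Q) \<and>
    outvars L (subst_query \<delta> Q) = map r (outvars L Q) \<and> set (outvars L Q) \<subseteq> vars_query Q"
  using assms
proof (induction Q)
  case (Cons a Q)
  have IH: "simply_moded L (subst_query \<delta> Q)" "outvars L (subst_query \<delta> Q) = map r (outvars L Q)"
    "set (outvars L Q) \<subseteq> vars_query Q"
    using Cons.IH[OF _ Cons.prems(2)] Cons.prems
    by (auto simp: simply_moded_def intro: inj_on_subset)
  have a: "wf_atom L a" "\<forall>t\<in>set (outs L a). is_Var t"
    using Cons.prems(1) by (auto simp: simply_moded_def)
  have va: "vars_list (ins L a) \<union> vars_list (outs L a) = vars_atom a"
    using vars_ins_outs[OF a(1)] by simp
  have outs: "occs_list (map (subst_trm \<delta>) (outs L a)) = map r (occs_list (outs L a))"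
    and ins: "occs_list (map (subst_trm \<delta>) (ins L a)) = map r (occs_list (ins L a))"
    using Cons.prems(3) va by (auto intro!: occs_list_rename)
  have sub: "set (outvars L (a # Q)) \<subseteq> vars_query (a # Q)"
    "vars_list (ins L a) \<subseteq> vars_query (a # Q)"
    using IH(3) va by (auto simp: vars_list_def)
  have eq: "outvars L (subst_query \<delta> (a # Q)) = map r (outvars L (a # Q))"
    using outs IH(2) by simp
  have "distinct (map r (outvars L (a # Q)))"
    using Cons.prems(1,4) sub(1) by (auto simp: distinct_map simply_moded_def simp del: outvars_simps
        intro: inj_on_subset)
  moreover have "vars_list (map (subst_trm \<delta>) (ins L a)) \<inter> set (map r (outvars L (a # Q))) = {}"
  proof -
    have "vars_list (ins L a) \<inter> set (outvars L (a # Q)) = {}"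
      using Cons.prems(1) by (simp add: simply_moded_def)
    then have "r ` vars_list (ins L a) \<inter> r ` set (outvars L (a # Q)) = {}"
      using inj_on_image_Int[OF Cons.prems(4) sub(2,1)] by simp
    then show ?thesis
      unfolding vars_list_def[of "map _ _"] ins by (simp add: vars_list_def image_Un)
  qed
  moreover have "\<forall>t\<in>set (map (subst_trm \<delta>) (outs L a)). is_Var t"
  proof
    fix t assume "t \<in> set (map (subst_trm \<delta>) (outs L a))"
    then obtain x where "Var x \<in> set (outs L a)" "t = \<delta> x"
      using a(2) by (auto simp: is_Var_def)
    moreover from this have "x \<in> vars_atom a"
      using va by (force simp: vars_list_eq)
    ultimately show "is_Var t"
      using Cons.prems(3) by simp
  qed
  ultimately have "simply_moded L (subst_query \<delta> (a # Q))"
    using IH(1) a Cons.prems(2) eq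
    by (auto simp: simply_moded_def wf_atom_subst simp del: outvars_simps)
  then show ?case
    using eq sub by blast
qed (simp add: simply_moded_def)

lemma moded_clause_variant:
  assumes "moded_clause L h B" "bij \<rho>"
  shows "moded_clause L (subst_atom (Var \<circ> \<rho>) h) (subst_query (Var \<circ> \<rho>) B)"
proof -
  have inj: "inj_on \<rho> A" for A
    using assms(2) by (auto simp: bij_def intro: inj_on_subset)
  have B: "simply_moded L (subst_query (Var \<circ> \<rho>) B)"
    "outvars L (subst_query (Var \<circ> \<rho>) B) = map \<rho> (outvars L B)"
    using simply_moded_rename[of L B "Var \<circ> \<rho>" \<rho>] assms inj by (auto simp: moded_clause_def)
  have "vars_list (map (subst_trm (Var \<circ> \<rho>)) (ins L h)) = \<rho> ` vars_list (ins L h)"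
    by (auto simp: vars_list_subst)
  then have "vars_list (map (subst_trm (Var \<circ> \<rho>)) (ins L h)) \<inter> set (map \<rho> (outvars L B)) = {}"
    using assms(1) inj_on_image_Int[OF inj[of UNIV], of "vars_list (ins L h)" "set (outvars L B)"]
    by (simp add: moded_clause_def)
  then show ?thesis
    using assms(1) B by (simp add: moded_clause_def wf_atom_subst)
qed

lemma typed_clause_variant:
  assumes "typed_clause L h B" "wf_subst L \<rho>"
  shows "typed_clause L (subst_atom \<rho> h) (subst_query \<rho> B)"
  unfolding typed_clause_def
proof (intro conjI allI impI)
  show "left_typed L (subst_query \<rho> B) (\<lambda>\<sigma>. ins_typed L (subst_atom \<sigma> (subst_atom \<rho> h)))"
    using assms by (auto simp: typed_clause_def subst_atom_comp intro: left_typed_subst)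
  fix \<sigma>
  assume "wf_subst L \<sigma>" "ins_typed L (subst_atom \<sigma> (subst_atom \<rho> h))"
    "\<forall>b\<in>set (subst_query \<rho> B). outs_typed L (subst_atom \<sigma> b)"
  then show "outs_typed L (subst_atom \<sigma> (subst_atom \<rho> h))"
    using assms wf_subst_comp[of L \<sigma> \<rho>]
    by (simp add: typed_clause_def set_subst_query flip: subst_atom_comp)
qed

section \<open>Resolvents of simply typed queries\<close>

lemma resolvent_left_typed:
  assumes Q: "left_typed L (Q\<^sub>1 @ a # Q\<^sub>2) (\<lambda>_. True)" and c: "typed_clause L h B"
    and \<theta>: "wf_subst L \<theta>" "subst_atom \<theta> a = subst_atom \<theta> h"
  shows "left_typed L (subst_query \<theta> (Q\<^sub>1 @ B @ Q\<^sub>2)) (\<lambda>_. True)"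
proof -
  let ?G = "\<lambda>\<sigma>. \<forall>b\<in>set (subst_query \<theta> Q\<^sub>1). outs_typed L (subst_atom \<sigma> b)"
  have G: "\<forall>b\<in>set Q\<^sub>1. outs_typed L (subst_atom (\<sigma> \<odot> \<theta>) b)" if "?G \<sigma>" for \<sigma>
    using that by (simp add: set_subst_query subst_atom_comp)
  have Q': "left_typed L Q\<^sub>1 (\<lambda>_. True)"
    "\<And>\<sigma>. wf_subst L \<sigma> \<Longrightarrow> (\<forall>b\<in>set Q\<^sub>1. outs_typed L (subst_atom \<sigma> b)) \<Longrightarrow> ins_typed L (subst_atom \<sigma> a)"
    "left_typed L Q\<^sub>2 (\<lambda>\<sigma>. (\<forall>b\<in>set Q\<^sub>1. outs_typed L (subst_atom \<sigma> b)) \<and> outs_typed L (subst_atom \<sigma> a))"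
    using Q by (simp_all add: left_typed_append)
  \<comment> \<open>The atoms of \<open>Q\<^sub>1\<close> type the inputs of \<open>a\<close>, which
    coincide with those of the head after unification. This starts the typing of the body;
    conversely, the typed body yields the typed head outputs, which stand in for the outputs of
    \<open>a\<close> before \<open>Q\<^sub>2\<close>.\<close>
  have h_ins: "ins_typed L (subst_atom (\<sigma> \<odot> \<theta>) h)" if "wf_subst L \<sigma>" "?G \<sigma>" for \<sigma>
    using Q'(2)[OF wf_subst_comp[OF that(1) \<theta>(1)] G[OF that(2)]] \<theta>(2) by (simp add: subst_atom_comp)
  have "left_typed L (subst_query \<theta> Q\<^sub>1) (\<lambda>_. True)"
    using Q'(1) \<theta>(1) by (rule left_typed_subst) simp
  moreover have "left_typed L (subst_query \<theta> B) ?G"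
    using c h_ins
    by (intro left_typed_subst[OF _ \<theta>(1), where G = "\<lambda>\<sigma>. ins_typed L (subst_atom \<sigma> h)"])
      (auto simp: typed_clause_def)
  moreover have "left_typed L (subst_query \<theta> Q\<^sub>2)
      (\<lambda>\<sigma>. ?G \<sigma> \<and> (\<forall>b\<in>set (subst_query \<theta> B). outs_typed L (subst_atom \<sigma> b)))"
  proof (rule left_typed_subst[OF Q'(3) \<theta>(1)], rule conjI)
    fix \<sigma>
    assume \<sigma>: "wf_subst L \<sigma>"
      and *: "?G \<sigma> \<and> (\<forall>b\<in>set (subst_query \<theta> B). outs_typed L (subst_atom \<sigma> b))"
    show "\<forall>b\<in>set Q\<^sub>1. outs_typed L (subst_atom (\<sigma> \<odot> \<theta>) b)"
      using * G by blast
    have "outs_typed L (subst_atom (\<sigma> \<odot> \<theta>) h)"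
    proof -
      have "\<forall>b\<in>set B. outs_typed L (subst_atom (\<sigma> \<odot> \<theta>) b)"
        using * by (simp add: set_subst_query subst_atom_comp)
      then show ?thesis
        using c h_ins[OF \<sigma>] * wf_subst_comp[OF \<sigma> \<theta>(1)] unfolding typed_clause_def by blast
    qed
    then show "outs_typed L (subst_atom (\<sigma> \<odot> \<theta>) a)"
      using \<theta>(2) by (simp add: subst_atom_comp)
  qed
  ultimately show ?thesis
    by (simp add: left_typed_append)
qed

lemma simply_moded_vars:
  assumes "simply_moded L Q" "b \<in> set Q"
  shows "vars_list (ins L b) \<subseteq> vars_query Q" "vars_list (outs L b) \<subseteq> vars_query Q"
  using assms vars_ins_outs[of L b] by (auto simp: simply_moded_def vars_query_def)

text \<open>All output variables of \<open>Q\<^sub>1\<close>, \<open>B\<close> and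
  \<open>Q\<^sub>2\<close> are fixed by \<open>\<theta>\<close>, and so are the inputs of
  \<open>Q\<^sub>1\<close>. The inputs of \<open>B\<close> can gain only variables of the inputs of
  \<open>a\<close>, those of \<open>Q\<^sub>2\<close> in addition only variables of the head.
  Renaming apart and the modes of the query keep the gains away from the outputs of \<open>B\<close>
  and \<open>Q\<^sub>2\<close> respectively.\<close>

lemma resolvent_simply_moded_matching:
  assumes Q: "simply_moded L (Q\<^sub>1 @ a # Q\<^sub>2)" and c: "moded_clause L h B"
    and apart: "vars_query (h # B) \<inter> vars_query (Q\<^sub>1 @ a # Q\<^sub>2) = {}"
    and \<theta>: "wf_subst L \<theta>"
    and fixed: "\<And>x. x \<notin> vars_list (ins L h) \<Longrightarrow> x \<notin> vars_list (outs L a) \<Longrightarrow> \<theta> x = Var x"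
    and ins_h: "\<And>x. x \<in> vars_list (ins L h) \<Longrightarrow> set (occs (\<theta> x)) \<subseteq> vars_list (ins L a)"
    and outs_a: "\<And>x. x \<in> vars_list (outs L a) \<Longrightarrow>
        set (occs (\<theta> x)) \<subseteq> vars_list (ins L a) \<union> vars_atom h"
  shows "simply_moded L (subst_query \<theta> (Q\<^sub>1 @ B @ Q\<^sub>2))"
proof -
  define VC VQ where "VC = vars_atom h \<union> vars_query B" and "VQ = vars_query (Q\<^sub>1 @ a # Q\<^sub>2)"
  have B: "simply_moded L B" and h: "wf_atom L h" "vars_list (ins L h) \<inter> set (outvars L B) = {}"
    using c by (auto simp: moded_clause_def)
  have vB: "set (outvars L B) \<subseteq> VC" "b \<in> set B \<Longrightarrow> vars_list (ins L b) \<subseteq> VC" for b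
    using simply_moded_vars[OF B] by (auto simp: set_outvars VC_def)
  have vQ: "set (outvars L Q\<^sub>1) \<union> set (outvars L Q\<^sub>2) \<union> vars_list (ins L a) \<union> vars_list (outs L a)
      \<subseteq> VQ"
    "b \<in> set Q\<^sub>1 \<union> set Q\<^sub>2 \<Longrightarrow> vars_list (ins L b) \<subseteq> VQ" for b
    using simply_moded_vars[OF Q] unfolding VQ_def by (auto simp: set_outvars)
  have vh: "vars_list (ins L h) \<subseteq> VC" "vars_atom h \<subseteq> VC"
    using vars_ins_outs[OF h(1)] by (auto simp: VC_def)
  have moded: "left_moded L Q\<^sub>1" "left_moded L Q\<^sub>2"
    "\<And>b. b \<in> set Q\<^sub>1 \<Longrightarrow> vars_list (ins L b) \<inter> (vars_list (outs L a) \<union> set (outvars L Q\<^sub>2)) = {}"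
    "vars_list (ins L a) \<inter> set (outvars L Q\<^sub>2) = {}"
    using Q by (auto simp: simply_moded_def left_moded_append vars_list_def)
  have dist: "distinct (outvars L Q\<^sub>1)" "distinct (outvars L Q\<^sub>2)"
    "set (outvars L Q\<^sub>1) \<inter> vars_list (outs L a) = {}" "set (outvars L Q\<^sub>2) \<inter> vars_list (outs L a) = {}"
    "set (outvars L Q\<^sub>1) \<inter> set (outvars L Q\<^sub>2) = {}"
    using Q by (auto simp: simply_moded_def vars_list_def)
  have apart': "VC \<inter> VQ = {}"
    using apart by (simp add: VC_def VQ_def)
  have out_fixed: "\<theta> x = Var x" if "x \<in> set (outvars L (Q\<^sub>1 @ B @ Q\<^sub>2))" for x
  proof (rule fixed)
    show "x \<notin> vars_list (ins L h)"
      using that h(2) vh vQ apart' by auto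
    show "x \<notin> vars_list (outs L a)"
      using that dist vQ vB apart' by auto
  qed
  have ins1: "\<theta> x = Var x" if "b \<in> set Q\<^sub>1" "x \<in> vars_list (ins L b)" for b x
    using that moded(3) vQ(2)[of b] vh apart' by (intro fixed) auto
  have insB: "set (occs (\<theta> x)) \<subseteq> insert x (vars_list (ins L a))"
    if "b \<in> set B" "x \<in> vars_list (ins L b)" for b x
  proof (cases "x \<in> vars_list (ins L h)")
    case False
    then have "\<theta> x = Var x"
      using that vB(2)[of b] vQ(1) apart' by (intro fixed) auto
    then show ?thesis by simp
  qed (use ins_h in auto)
  have ins2: "set (occs (\<theta> x)) \<subseteq> insert x (vars_list (ins L a) \<union> vars_atom h)"
    if "b \<in> set Q\<^sub>2" "x \<in> vars_list (ins L b)" for b x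
  proof (cases "x \<in> vars_list (outs L a)")
    case False
    then have "\<theta> x = Var x"
      using that vQ(2)[of b] vh apart' by (intro fixed) auto
    then show ?thesis by simp
  qed (use outs_a in auto)
  have s1: "left_moded L (subst_query \<theta> Q\<^sub>1) \<and> outvars L (subst_query \<theta> Q\<^sub>1) = outvars L Q\<^sub>1"
    using moded(1) out_fixed ins1 by (intro left_moded_subst[where V = "{}"]) auto
  have sB: "left_moded L (subst_query \<theta> B) \<and> outvars L (subst_query \<theta> B) = outvars L B"
    using B vB vQ apart' out_fixed insB
    by (intro left_moded_subst[where V = "vars_list (ins L a)"]) (auto simp: simply_moded_def)
  have s2: "left_moded L (subst_query \<theta> Q\<^sub>2) \<and> outvars L (subst_query \<theta> Q\<^sub>2) = outvars L Q\<^sub>2"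
    using moded(2,4) vQ vh(2) apart' out_fixed ins2
    by (intro left_moded_subst[where V = "vars_list (ins L a) \<union> vars_atom h"]) auto
  have eq: "outvars L (subst_query \<theta> (Q\<^sub>1 @ B @ Q\<^sub>2)) = outvars L (Q\<^sub>1 @ B @ Q\<^sub>2)"
    using s1 sB s2 by simp
  have "vars_list (map (subst_trm \<theta>) (ins L b)) \<inter> set (outvars L (B @ Q\<^sub>2)) = {}" if b: "b \<in> set Q\<^sub>1" for b
  proof -
    have "map (subst_trm \<theta>) (ins L b) = ins L b"
      using map_subst_trm_cong[of "ins L b" \<theta> Var] ins1[OF b] by simp
    then show ?thesis
      using moded(3)[OF b] vQ(2)[of b] b vB apart' by (simp, blast)
  qed
  moreover have "vars_list (map (subst_trm \<theta>) (ins L b)) \<inter> set (outvars L Q\<^sub>2) = {}"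
    if b: "b \<in> set B" for b
  proof -
    have "vars_list (map (subst_trm \<theta>) (ins L b)) \<subseteq> vars_list (ins L b) \<union> vars_list (ins L a)"
      unfolding vars_list_subst using insB[OF b] by blast
    then show ?thesis
      using moded(4) vB(2)[OF b] vQ(1) apart' by blast
  qed
  ultimately have "left_moded L (subst_query \<theta> (Q\<^sub>1 @ B @ Q\<^sub>2))"
    using s1 sB s2 by (auto simp: left_moded_append set_subst_query)
  moreover have "distinct (outvars L (Q\<^sub>1 @ B @ Q\<^sub>2))"
    using dist B vB vQ apart' by (auto simp: simply_moded_def)
  moreover have "wf_atom L (subst_atom \<theta> b) \<and> (\<forall>t\<in>set (outs L (subst_atom \<theta> b)). is_Var t)"
    if b: "b \<in> set (Q\<^sub>1 @ B @ Q\<^sub>2)" for b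
  proof -
    have wf: "wf_atom L b" "\<forall>t\<in>set (outs L b). is_Var t"
      using b Q B by (auto simp: simply_moded_def)
    have "vars_list (outs L b) \<subseteq> set (outvars L (Q\<^sub>1 @ B @ Q\<^sub>2))"
      using b by (auto simp: set_outvars)
    then have "map (subst_trm \<theta>) (outs L b) = outs L b"
      using map_subst_trm_cong[of "outs L b" \<theta> Var] out_fixed by auto
    then show ?thesis
      using wf \<theta> by (simp add: wf_atom_subst)
  qed
  then have "\<forall>b\<in>set (subst_query \<theta> (Q\<^sub>1 @ B @ Q\<^sub>2)). wf_atom L b \<and> (\<forall>t\<in>set (outs L b). is_Var t)"
    unfolding set_subst_query by blast
  ultimately show ?thesis
    unfolding simply_moded_def eq by blast
qed

text \<open>Each mgu factors through the other, so \<open>\<delta>\<close> has a left inverse on the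
  variables of the instantiated query and must send them injectively to variables. Off that set, a
  factoring substitution may be arbitrary.\<close>

lemma mgu_variants:
  assumes "is_mgu L \<theta> a b" "is_mgu L \<theta>' a b"
  obtains \<delta> r where "wf_subst L \<delta>" "\<theta>' = \<delta> \<odot> \<theta>"
    "\<And>x. x \<in> vars_query (subst_query \<theta> Q) \<Longrightarrow> \<delta> x = Var (r x)" "inj_on r (vars_query (subst_query \<theta> Q))"
proof -
  obtain \<delta> where \<delta>: "wf_subst L \<delta>" "\<theta>' = \<delta> \<odot> \<theta>"
    using assms by (fastforce simp: is_mgu_def subst_comp_def)
  obtain \<delta>' where \<delta>': "\<theta> = \<delta>' \<odot> \<theta>'"
    using assms by (fastforce simp: is_mgu_def subst_comp_def)
  have inv: "subst_trm \<delta>' (\<delta> x) = Var x" if "x \<in> vars_query (subst_query \<theta> Q)" for x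
  proof -
    have "subst_query (\<delta>' \<odot> \<delta>) (subst_query \<theta> Q) = subst_query Var (subst_query \<theta> Q)"
      using \<delta>(2) \<delta>' by (metis subst_query_comp subst_query_Var)
    from subst_query_eqD[OF this that] show ?thesis
      by (simp add: subst_comp_def)
  qed
  have "\<exists>y. \<delta> x = Var y" if "x \<in> vars_query (subst_query \<theta> Q)" for x
    using inv[OF that] by (cases "\<delta> x") auto
  then obtain r where r: "\<And>x. x \<in> vars_query (subst_query \<theta> Q) \<Longrightarrow> \<delta> x = Var (r x)"
    by metis
  moreover have "inj_on r (vars_query (subst_query \<theta> Q))"
  proof (rule inj_onI)
    fix x y
    assume "x \<in> vars_query (subst_query \<theta> Q)" "y \<in> vars_query (subst_query \<theta> Q)" "r x = r y"
    then have "(Var x :: 'a trm) = Var y"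
      using inv r by metis
    then show "x = y" by simp
  qed
  ultimately show thesis
    using that \<delta> by blast
qed

lemma simply_moded_selected:
  assumes "simply_moded L (Q\<^sub>1 @ a # Q\<^sub>2)"
  obtains ys where "wf_atom L a" "outs L a = map Var ys" "distinct ys"
    "vars_list (ins L a) \<inter> set ys = {}"
proof
  show "wf_atom L a" "outs L a = map Var (occs_list (outs L a))"
    using assms by (auto simp: simply_moded_def intro: occs_list_map_Var)
  show "distinct (occs_list (outs L a))" "vars_list (ins L a) \<inter> set (occs_list (outs L a)) = {}"
    using assms by (auto simp: simply_moded_def left_moded_append)
qed

text \<open>A derivation may use any mgu, while modes are easy to check only for the explicit
  matching one. The two resolvents differ by a renaming, which preserves modes.\<close>

lemma resolvent_simply_moded:
  assumes Q: "simply_moded L (Q\<^sub>1 @ a # Q\<^sub>2)" and c: "moded_clause L h B"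
    and apart: "vars_query (h # B) \<inter> vars_query (Q\<^sub>1 @ a # Q\<^sub>2) = {}"
    and mgu: "is_mgu L \<theta> a h"
    and \<mu>: "wf_subst L \<mu>" "map (subst_trm \<mu>) (ins L h) = ins L a"
  shows "simply_moded L (subst_query \<theta> (Q\<^sub>1 @ B @ Q\<^sub>2))"
proof -
  obtain ys where a: "wf_atom L a" "outs L a = map Var ys" "distinct ys"
    "vars_list (ins L a) \<inter> set ys = {}"
    using Q by (rule simply_moded_selected)
  have p: "psym h = psym a"
    using mgu by (metis is_mgu_def unifier_def psym_subst_atom)
  have h: "wf_atom L h"
    using c by (simp add: moded_clause_def)
  have "vars_atom h \<inter> vars_atom a = {}"
    using apart by auto
  then obtain \<theta>\<^sub>0 where \<theta>\<^sub>0: "is_mgu L \<theta>\<^sub>0 a h"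
    "\<And>x. x \<notin> vars_list (ins L h) \<Longrightarrow> x \<notin> vars_list (outs L a) \<Longrightarrow> \<theta>\<^sub>0 x = Var x"
    "\<And>x. x \<in> vars_list (ins L h) \<Longrightarrow> set (occs (\<theta>\<^sub>0 x)) \<subseteq> vars_list (ins L a)"
    "\<And>x. x \<in> vars_list (outs L a) \<Longrightarrow> set (occs (\<theta>\<^sub>0 x)) \<subseteq> vars_list (ins L a) \<union> vars_atom h"
    using matching_mgu[OF a(1) h p a(2-4) _ \<mu>] by metis
  have "wf_subst L \<theta>\<^sub>0"
    using \<theta>\<^sub>0(1) by (simp add: is_mgu_def unifier_def)
  then have moded: "simply_moded L (subst_query \<theta>\<^sub>0 (Q\<^sub>1 @ B @ Q\<^sub>2))"
    using resolvent_simply_moded_matching[OF Q c apart _ \<theta>\<^sub>0(2-4)] by simp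
  obtain \<delta> r where \<delta>: "wf_subst L \<delta>" "\<theta> = \<delta> \<odot> \<theta>\<^sub>0"
    "\<And>x. x \<in> vars_query (subst_query \<theta>\<^sub>0 (Q\<^sub>1 @ B @ Q\<^sub>2)) \<Longrightarrow> \<delta> x = Var (r x)"
    "inj_on r (vars_query (subst_query \<theta>\<^sub>0 (Q\<^sub>1 @ B @ Q\<^sub>2)))"
    using mgu_variants[OF \<theta>\<^sub>0(1) mgu] by metis
  show ?thesis
    using simply_moded_rename[OF moded \<delta>(1,3,4)] unfolding \<delta>(2) subst_query_comp by blast
qed


section \<open>Derivations that never instantiate an input\<close>

lemma fresh_renaming:
  assumes "finite V" "finite W"
  obtains \<rho> :: "nat \<Rightarrow> nat" where "bij \<rho>" "\<rho> ` W \<inter> V = {}"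
proof -
  obtain N where N: "\<And>x. x \<in> V \<union> W \<Longrightarrow> x < N"
    using assms by (metis finite_UnI finite_nat_set_iff_bounded)
  \<comment> \<open>The involution exchanging the blocks below \<open>N\<close> and from
    \<open>N\<close> to \<open>2 * N - 1\<close>. A bijection of all variables is required because
    variants are defined by bijective renamings.\<close>
  define \<rho> where "\<rho> x = (if x < N then x + N else if x < 2 * N then x - N else x)" for x
  have "\<rho> (\<rho> x) = x" for x
    by (auto simp: \<rho>_def)
  then have "bij \<rho>"
    by (rule involuntory_imp_bij)
  moreover have "\<rho> ` W \<inter> V = {}"
    using N by (force simp: \<rho>_def)
  ultimately show thesis
    by (rule that)
qed

lemma vars_query_rename: "vars_query (subst_query (Var \<circ> \<rho>) Q) = \<rho> ` vars_query Q"
  by (induction Q) (auto simp: vars_atom_def vars_list_subst)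

lemma variantD:
  assumes "is_variant (h', B') (h, B)"
  obtains \<rho> where "bij \<rho>" "h' = subst_atom (Var \<circ> \<rho>) h" "B' = subst_query (Var \<circ> \<rho>) B"
  using assms by auto

text \<open>A substitution \<open>\<sigma>\<close> for the query and a substitution
  \<open>\<tau>\<close> for the original clause are combined by using \<open>\<tau>\<close>, after
  undoing the renaming, on the variables of the variant, and \<open>\<sigma>\<close>
  elsewhere.\<close>

lemma merge_substs:
  assumes "is_variant (h', B') (h, B)" "wf_subst L \<sigma>" "wf_subst L \<tau>"
  obtains \<kappa> where "wf_subst L \<kappa>" "subst_atom \<kappa> h' = subst_atom \<tau> h"
    "subst_query \<kappa> B' = subst_query \<tau> B" "\<And>x. x \<notin> vars_query (h' # B') \<Longrightarrow> \<kappa> x = \<sigma> x"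
proof -
  obtain \<rho> where \<rho>: "bij \<rho>" "h' = subst_atom (Var \<circ> \<rho>) h" "B' = subst_query (Var \<circ> \<rho>) B"
    using assms(1) by (rule variantD)
  define \<kappa> where "\<kappa> x = (if x \<in> vars_query (h' # B') then \<tau> (inv \<rho> x) else \<sigma> x)" for x
  have "subst_query \<kappa> (h' # B') = subst_query (\<tau> \<circ> inv \<rho>) (h' # B')"
    by (rule subst_query_cong) (simp add: \<kappa>_def)
  also have "\<dots> = subst_query ((\<tau> \<circ> inv \<rho>) \<odot> (Var \<circ> \<rho>)) (h # B)"
    using \<rho>(2,3) by (simp add: subst_query_comp subst_atom_comp)
  also have "(\<tau> \<circ> inv \<rho>) \<odot> (Var \<circ> \<rho>) = \<tau>"
    using \<rho>(1) by (auto simp: subst_comp_def bij_is_inj)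
  finally have "subst_query \<kappa> (h' # B') = subst_query \<tau> (h # B)" .
  moreover have "wf_subst L \<kappa>"
    using assms(2,3) by (simp add: \<kappa>_def wf_subst_def)
  ultimately show thesis
    using that by (simp add: \<kappa>_def)
qed

text \<open>A view of the program without permutations and block declarations. In
  \<open>unifiable\<close>, the pair \<open>\<sigma>\<close>, \<open>\<tau>\<close> replaces
  renaming apart.\<close>

locale simply_typed_program =
  fixes L :: "('f, 'p) language" and P :: "('f, 'p) program"
  assumes language: "wf_language L"
    and head_linear: "(h, B) \<in> clauses P \<Longrightarrow> linear (ins L h)"
    and head_flat: "(h, B) \<in> clauses P \<Longrightarrow> i \<in> positions L (psym h) Input \<Longrightarrow> flat (args h ! i)"
    and head_nonvar: "(h, B) \<in> clauses P \<Longrightarrow> i \<in> positions L (psym h) Input \<Longrightarrow>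
      \<not> is_Var (args h ! i) \<Longrightarrow> ptype L (psym h) ! i \<noteq> variable_type L"
    and moded: "(h, B) \<in> clauses P \<Longrightarrow> moded_clause L h B"
    and typed: "(h, B) \<in> clauses P \<Longrightarrow> typed_clause L h B"
    and unifiable: "simply_typed L [a] \<Longrightarrow> psym a \<in> preds P \<Longrightarrow>
      \<exists>h B \<sigma> \<tau>. (h, B) \<in> clauses P \<and> wf_subst L \<sigma> \<and> wf_subst L \<tau> \<and> subst_atom \<sigma> a = subst_atom \<tau> h"
begin

definition good :: "('f, 'p) query \<Rightarrow> bool" where
  "good Q \<longleftrightarrow> simply_typed L Q \<and> psym ` set Q \<subseteq> preds P"

text \<open>The common ground of the two selection rules: selected atoms of the given derivation are
  ready by input selectability, leftmost atoms by typing. Since all heads for the predicate are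
  considered, unifiability of a ready atom with any of them implies matching.\<close>

definition ready :: "('f, 'p) atom \<Rightarrow> bool" where
  "ready a \<longleftrightarrow> wf_atom L a \<and> (\<forall>(h, B)\<in>clauses P. psym h = psym a \<longrightarrow>
     (\<forall>i\<in>positions L (psym h) Input. \<not> is_Var (args h ! i) \<longrightarrow> \<not> is_Var (args a ! i)))"

text \<open>The original clause is kept beside its variant, because replaying a step reuses the
  clause but renames it afresh.\<close>

definition matching_step where
  "matching_step h B h' B' \<theta> Q\<^sub>1 a Q\<^sub>2 \<longleftrightarrow> (h, B) \<in> clauses P \<and> ready a \<and> is_variant (h', B') (h, B) \<and>
     vars_query (h' # B') \<inter> vars_query (Q\<^sub>1 @ a # Q\<^sub>2) = {} \<and> is_mgu L \<theta> a h'"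

text \<open>Infinite derivations selecting ready atoms at any position. As a greatest fixpoint,
  divergence follows from an invariant preserved by one step, without constructing a
  sequence.\<close>

coinductive diverges where
  "matching_step h B h' B' \<theta> Q\<^sub>1 a Q\<^sub>2 \<Longrightarrow> diverges (subst_query \<theta> (Q\<^sub>1 @ B' @ Q\<^sub>2)) \<Longrightarrow>
   diverges (Q\<^sub>1 @ a # Q\<^sub>2)"

text \<open>\<open>resolved_first h B b U\<close>: some infinite derivation of \<open>b, U\<close> resolves \<open>b\<close> at some
  point, with the clause \<open>h \<leftarrow> B\<close>.\<close>

inductive resolved_first for h B where
  now: "matching_step h B h' B' \<theta> [] b U \<Longrightarrow> diverges (subst_query \<theta> (B' @ U)) \<Longrightarrow>
    resolved_first h B b U"
| later: "matching_step k C k' C' \<theta> (b # U\<^sub>1) a U\<^sub>2 \<Longrightarrow>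
    resolved_first h B (subst_atom \<theta> b) (subst_query \<theta> (U\<^sub>1 @ C' @ U\<^sub>2)) \<Longrightarrow>
    resolved_first h B b (U\<^sub>1 @ a # U\<^sub>2)"

section \<open>Persistence, existence and instantiation of matching steps\<close>

lemma goodD: "good Q \<Longrightarrow> simply_moded L Q" "good Q \<Longrightarrow> left_typed L Q (\<lambda>_. True)"
  by (auto simp: good_def simply_typed_def)

lemma ready_subst:
  assumes "ready a" "wf_subst L \<sigma>"
  shows "ready (subst_atom \<sigma> a)"
proof -
  have "\<not> is_Var (subst_trm \<sigma> t)" if "\<not> is_Var t" for t
    using that is_Var_substD by blast
  then show ?thesis
    using assms by (fastforce simp: ready_def positions_def wf_atom_def wf_trm_subst)
qed

lemma matcher_ex_clause:
  assumes "ready a" "(h, B) \<in> clauses P" "subst_atom \<sigma> a = subst_atom \<tau> h"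
  obtains \<mu> where "wf_subst L \<mu>" "map (subst_trm \<mu>) (ins L h) = ins L a"
proof -
  have "psym h = psym a"
    using assms(3) by (metis psym_subst_atom)
  then have "\<exists>\<mu>. wf_subst L \<mu> \<and> map (subst_trm \<mu>) (ins L h) = ins L a"
    using assms moded[OF assms(2)] head_linear[OF assms(2)] head_flat[OF assms(2)]
    by (intro matcher_ex) (auto simp: ready_def moded_clause_def)
  then show thesis
    using that by blast
qed

lemma good_resolvent:
  assumes good: "good (Q\<^sub>1 @ a # Q\<^sub>2)" and step: "matching_step h B h' B' \<theta> Q\<^sub>1 a Q\<^sub>2"
  shows "good (subst_query \<theta> (Q\<^sub>1 @ B' @ Q\<^sub>2))"
proof -
  have s: "(h, B) \<in> clauses P" "ready a" "is_variant (h', B') (h, B)"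
    "vars_query (h' # B') \<inter> vars_query (Q\<^sub>1 @ a # Q\<^sub>2) = {}" "is_mgu L \<theta> a h'"
    using step by (auto simp: matching_step_def)
  obtain \<rho> where \<rho>: "bij \<rho>" "h' = subst_atom (Var \<circ> \<rho>) h" "B' = subst_query (Var \<circ> \<rho>) B"
    using s(3) by (rule variantD)
  have \<theta>: "wf_subst L \<theta>" "subst_atom \<theta> a = subst_atom \<theta> h'"
    using s(5) by (auto simp: is_mgu_def unifier_def)
  have "subst_atom \<theta> a = subst_atom (\<theta> \<odot> (Var \<circ> \<rho>)) h"
    using \<theta>(2) \<rho>(2) by (simp add: subst_atom_comp)
  then obtain \<mu> where "wf_subst L \<mu>" "map (subst_trm \<mu>) (ins L h) = ins L a"
    using matcher_ex_clause[OF s(2,1)] by metis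
  then obtain \<mu>' where \<mu>': "wf_subst L \<mu>'" "map (subst_trm \<mu>') (ins L h') = ins L a"
    using matcher_variant[OF \<rho>(1)] \<rho>(2) by metis
  have "simply_moded L (subst_query \<theta> (Q\<^sub>1 @ B' @ Q\<^sub>2))"
    using resolvent_simply_moded[OF goodD(1)[OF good] _ s(4,5) \<mu>'] moded_clause_variant[OF moded[OF s(1)] \<rho>(1)] \<rho>
    by simp
  moreover have "left_typed L (subst_query \<theta> (Q\<^sub>1 @ B' @ Q\<^sub>2)) (\<lambda>_. True)"
    using resolvent_left_typed[OF goodD(2)[OF good] _ \<theta>] typed_clause_variant[OF typed[OF s(1)]] \<rho>
    by simp
  moreover have "psym ` set B' \<subseteq> preds P"
  proof -
    have "psym ` set B' = psym ` set B"
      using \<rho>(3) by (simp add: set_subst_query image_image)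
    then show ?thesis
      using s(1) by (auto simp: preds_def intro!: bexI[of _ "(h, B)"])
  qed
  ultimately show ?thesis
    using good by (auto simp: good_def simply_typed_def set_subst_query)
qed

text \<open>In a good query the outputs of \<open>a\<close> are distinct variables absent from its
  inputs, so a match on the inputs alone already permits the step.\<close>

lemma matching_step_ex:
  assumes good: "good (Q\<^sub>1 @ a # Q\<^sub>2)" and a: "ready a" and c: "(h, B) \<in> clauses P" "psym h = psym a"
    and \<mu>: "wf_subst L \<mu>" "map (subst_trm \<mu>) (ins L h) = ins L a"
  obtains \<rho> \<theta> where "bij \<rho>"
    "matching_step h B (subst_atom (Var \<circ> \<rho>) h) (subst_query (Var \<circ> \<rho>) B) \<theta> Q\<^sub>1 a Q\<^sub>2"
proof -
  obtain \<rho> where \<rho>: "bij \<rho>" "\<rho> ` vars_query (h # B) \<inter> vars_query (Q\<^sub>1 @ a # Q\<^sub>2) = {}"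
    using fresh_renaming finite_vars_query by metis
  let ?h = "subst_atom (Var \<circ> \<rho>) h"
  have apart: "vars_query (?h # subst_query (Var \<circ> \<rho>) B) \<inter> vars_query (Q\<^sub>1 @ a # Q\<^sub>2) = {}"
    using \<rho>(2) vars_query_rename[of \<rho> "h # B"] by simp
  obtain \<mu>' where \<mu>': "wf_subst L \<mu>'" "map (subst_trm \<mu>') (ins L ?h) = ins L a"
    using matcher_variant[OF \<rho>(1) \<mu>(2,1)] by metis
  obtain ys where ys: "wf_atom L a" "outs L a = map Var ys" "distinct ys"
    "vars_list (ins L a) \<inter> set ys = {}"
    using goodD(1)[OF good] by (rule simply_moded_selected)
  have "wf_atom L ?h"
    using moded[OF c(1)] by (simp add: moded_clause_def wf_atom_subst)
  moreover have "vars_atom ?h \<inter> vars_atom a = {}"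
    using apart by auto
  ultimately obtain \<theta> where "is_mgu L \<theta> a ?h"
    using matching_mgu[OF ys(1) _ _ ys(2-4) _ \<mu>'] c(2) by (metis psym_subst_atom)
  then have "matching_step h B ?h (subst_query (Var \<circ> \<rho>) B) \<theta> Q\<^sub>1 a Q\<^sub>2"
    using a c(1) apart \<rho>(1) by (auto simp: matching_step_def)
  then show thesis
    using that \<rho>(1) by blast
qed

text \<open>\<open>\<sigma>\<close> on the query and \<open>\<tau>\<close> on the clause merge into
  one unifier of \<open>a\<close> and \<open>h'\<close>, which factors through the mgu. The last
  conclusion also covers variables foreign to the query; it is used to follow an atom that has been
  taken out of it.\<close>

lemma matching_step_factor:
  assumes step: "matching_step h B h' B' \<theta> Q\<^sub>1 a Q\<^sub>2"
    and wf: "wf_subst L \<sigma>" "wf_subst L \<tau>" and eq: "subst_atom \<sigma> a = subst_atom \<tau> h"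
  obtains \<delta> where "wf_subst L \<delta>"
    "subst_query \<delta> (subst_query \<theta> (Q\<^sub>1 @ B' @ Q\<^sub>2)) = subst_query \<sigma> Q\<^sub>1 @ subst_query \<tau> B @ subst_query \<sigma> Q\<^sub>2"
    "\<And>x. x \<notin> vars_query (h' # B') \<Longrightarrow> (\<delta> \<odot> \<theta>) x = \<sigma> x"
proof -
  have s: "is_variant (h', B') (h, B)"
    "vars_query (h' # B') \<inter> vars_query (Q\<^sub>1 @ a # Q\<^sub>2) = {}" "is_mgu L \<theta> a h'"
    using step by (auto simp: matching_step_def)
  obtain \<kappa> where \<kappa>: "wf_subst L \<kappa>" "subst_atom \<kappa> h' = subst_atom \<tau> h"
    "subst_query \<kappa> B' = subst_query \<tau> B" "\<And>x. x \<notin> vars_query (h' # B') \<Longrightarrow> \<kappa> x = \<sigma> x"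
    using merge_substs[OF s(1) wf] by metis
  have "subst_query \<kappa> (Q\<^sub>1 @ a # Q\<^sub>2) = subst_query \<sigma> (Q\<^sub>1 @ a # Q\<^sub>2)"
    using s(2) by (intro subst_query_cong \<kappa>(4)) blast
  then have Q: "subst_query \<kappa> Q\<^sub>1 = subst_query \<sigma> Q\<^sub>1" "subst_atom \<kappa> a = subst_atom \<sigma> a"
    "subst_query \<kappa> Q\<^sub>2 = subst_query \<sigma> Q\<^sub>2"
    by (simp_all add: subst_query_def)
  then have "unifier L \<kappa> a h'"
    using \<kappa>(1,2) eq by (simp add: unifier_def)
  then obtain \<delta> where \<delta>: "wf_subst L \<delta>" "\<kappa> = \<delta> \<odot> \<theta>"
    using s(3) by (fastforce simp: is_mgu_def subst_comp_def)
  show thesis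
  proof (rule that[OF \<delta>(1)])
    show "subst_query \<delta> (subst_query \<theta> (Q\<^sub>1 @ B' @ Q\<^sub>2)) =
        subst_query \<sigma> Q\<^sub>1 @ subst_query \<tau> B @ subst_query \<sigma> Q\<^sub>2"
      using Q \<kappa>(3) unfolding \<delta>(2) subst_query_comp by simp
  qed (use \<kappa>(4) \<delta>(2) in simp)
qed

text \<open>A matcher composed with \<open>\<sigma>\<close> matches the instance, so the same clause
  applies under \<open>\<sigma>\<close> and to the right of \<open>C\<close>. The new resolvent
  again has the form of a context followed by an instance of the old resolvent.\<close>

lemma matching_step_lift:
  assumes step: "matching_step h B h' B' \<theta> Q\<^sub>1 a Q\<^sub>2"
    and good: "good (C @ subst_query \<sigma> (Q\<^sub>1 @ a # Q\<^sub>2))" and \<sigma>: "wf_subst L \<sigma>"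
  obtains h'' B'' \<theta>' \<delta> where "wf_subst L \<theta>'" "wf_subst L \<delta>"
    "matching_step h B h'' B'' \<theta>' (C @ subst_query \<sigma> Q\<^sub>1) (subst_atom \<sigma> a) (subst_query \<sigma> Q\<^sub>2)"
    "subst_query \<theta>' ((C @ subst_query \<sigma> Q\<^sub>1) @ B'' @ subst_query \<sigma> Q\<^sub>2) =
      subst_query \<theta>' C @ subst_query \<delta> (subst_query \<theta> (Q\<^sub>1 @ B' @ Q\<^sub>2))"
    "\<And>x. x \<notin> vars_query (h' # B') \<Longrightarrow> (\<delta> \<odot> \<theta>) x = (\<theta>' \<odot> \<sigma>) x"
proof -
  have s: "(h, B) \<in> clauses P" "ready a" "is_variant (h', B') (h, B)" "is_mgu L \<theta> a h'"
    using step by (auto simp: matching_step_def)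
  obtain \<rho> where \<rho>: "bij \<rho>" "h' = subst_atom (Var \<circ> \<rho>) h" "B' = subst_query (Var \<circ> \<rho>) B"
    using s(3) by (rule variantD)
  have eq: "subst_atom \<theta> a = subst_atom (\<theta> \<odot> (Var \<circ> \<rho>)) h"
    using s(4) \<rho>(2) by (simp add: subst_atom_comp is_mgu_def unifier_def)
  then obtain \<mu> where \<mu>: "wf_subst L \<mu>" "map (subst_trm \<mu>) (ins L h) = ins L a"
    using matcher_ex_clause[OF s(2,1)] by metis
  have "psym h = psym (subst_atom \<sigma> a)"
    using eq by (metis psym_subst_atom)
  moreover have "map (subst_trm (\<sigma> \<odot> \<mu>)) (ins L h) = ins L (subst_atom \<sigma> a)"
    using \<mu>(2) by (simp add: map_subst_trm_comp del: list.map_comp)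
  moreover have "good ((C @ subst_query \<sigma> Q\<^sub>1) @ subst_atom \<sigma> a # subst_query \<sigma> Q\<^sub>2)"
    using good by simp
  ultimately obtain \<rho>' \<theta>' where step': "matching_step h B (subst_atom (Var \<circ> \<rho>') h)
      (subst_query (Var \<circ> \<rho>') B) \<theta>' (C @ subst_query \<sigma> Q\<^sub>1) (subst_atom \<sigma> a) (subst_query \<sigma> Q\<^sub>2)"
    using matching_step_ex ready_subst[OF s(2) \<sigma>] s(1) wf_subst_comp[OF \<sigma> \<mu>(1)] by metis
  then have \<theta>': "wf_subst L \<theta>'"
    "subst_atom (\<theta>' \<odot> \<sigma>) a = subst_atom (\<theta>' \<odot> (Var \<circ> \<rho>')) h"
    by (auto simp: matching_step_def is_mgu_def unifier_def subst_atom_comp)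
  \<comment> \<open>The mgu \<open>\<theta>'\<close> of the replayed step, seen from the original
    step, instantiates the query by \<open>\<theta>' \<odot> \<sigma>\<close> and the clause by
    \<open>\<theta>' \<odot> (Var \<circ> \<rho>')\<close>; this pair is what gets factored through
    \<open>\<theta>\<close>.\<close>
  obtain \<delta> where \<delta>: "wf_subst L \<delta>"
    "subst_query \<delta> (subst_query \<theta> (Q\<^sub>1 @ B' @ Q\<^sub>2)) =
      subst_query (\<theta>' \<odot> \<sigma>) Q\<^sub>1 @ subst_query (\<theta>' \<odot> (Var \<circ> \<rho>')) B @ subst_query (\<theta>' \<odot> \<sigma>) Q\<^sub>2"
    "\<And>x. x \<notin> vars_query (h' # B') \<Longrightarrow> (\<delta> \<odot> \<theta>) x = (\<theta>' \<odot> \<sigma>) x"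
    using matching_step_factor[OF step wf_subst_comp[OF \<theta>'(1) \<sigma>] wf_subst_comp[OF \<theta>'(1)] \<theta>'(2)]
    by (metis wf_subst_Var(2))
  show thesis
  proof (rule that[OF \<theta>'(1) \<delta>(1) step' _ \<delta>(3)])
    show "subst_query \<theta>' ((C @ subst_query \<sigma> Q\<^sub>1) @ subst_query (Var \<circ> \<rho>') B @ subst_query \<sigma> Q\<^sub>2) =
        subst_query \<theta>' C @ subst_query \<delta> (subst_query \<theta> (Q\<^sub>1 @ B' @ Q\<^sub>2))"
      unfolding \<delta>(2) by (simp add: subst_query_comp)
  qed
qed

lemma diverges_lift:
  assumes "diverges Q" "good (C @ subst_query \<sigma> Q)" "wf_subst L \<sigma>"
  shows "diverges (C @ subst_query \<sigma> Q)"
proof -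
  \<comment> \<open>Closed under steps: \<open>subst_query \<theta>' C\<close> is the next context
    and \<open>\<delta>\<close> the next substitution, while \<open>Q\<close> follows its own
    derivation.\<close>
  define X where "X R \<longleftrightarrow> (\<exists>C \<sigma> Q. R = C @ subst_query \<sigma> Q \<and> diverges Q \<and> good R \<and> wf_subst L \<sigma>)" for R
  have "X (C @ subst_query \<sigma> Q)"
    using assms by (auto simp: X_def)
  then show ?thesis
  proof (coinduct rule: diverges.coinduct)
    case (diverges R)
    then obtain C \<sigma> Q where R: "R = C @ subst_query \<sigma> Q" "diverges Q" "good R" "wf_subst L \<sigma>"
      by (auto simp: X_def)
    from R(2) obtain h B h' B' \<theta> Q\<^sub>1 a Q\<^sub>2 where Q: "Q = Q\<^sub>1 @ a # Q\<^sub>2"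
      and step: "matching_step h B h' B' \<theta> Q\<^sub>1 a Q\<^sub>2" and div: "diverges (subst_query \<theta> (Q\<^sub>1 @ B' @ Q\<^sub>2))"
      by (auto elim: diverges.cases)
    obtain h'' B'' \<theta>' \<delta> where lift: "wf_subst L \<delta>"
      "matching_step h B h'' B'' \<theta>' (C @ subst_query \<sigma> Q\<^sub>1) (subst_atom \<sigma> a) (subst_query \<sigma> Q\<^sub>2)"
      "subst_query \<theta>' ((C @ subst_query \<sigma> Q\<^sub>1) @ B'' @ subst_query \<sigma> Q\<^sub>2) =
        subst_query \<theta>' C @ subst_query \<delta> (subst_query \<theta> (Q\<^sub>1 @ B' @ Q\<^sub>2))"
      using matching_step_lift[OF step R(3)[unfolded R(1) Q] R(4)] by metis
    have R': "R = (C @ subst_query \<sigma> Q\<^sub>1) @ subst_atom \<sigma> a # subst_query \<sigma> Q\<^sub>2"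
      using R(1) Q by simp
    have "X (subst_query \<theta>' ((C @ subst_query \<sigma> Q\<^sub>1) @ B'' @ subst_query \<sigma> Q\<^sub>2))"
      using good_resolvent[OF R(3)[unfolded R'] lift(2)] lift(1) div unfolding X_def lift(3) by blast
    then show ?case
      using R' lift(2) by blast
  qed
qed

section \<open>Exchanging or deleting the resolution of the leftmost atom\<close>

lemma matching_step_tail:
  "matching_step h B h' B' \<theta> (b # Q\<^sub>1) a Q\<^sub>2 \<Longrightarrow>
    matching_step h B h' B' \<theta> Q\<^sub>1 a Q\<^sub>2 \<and> vars_query (h' # B') \<inter> vars_atom b = {}"
  by (auto simp: matching_step_def)

text \<open>The steps preceding the resolution of \<open>b\<close> are replayed with the body of its
  clause already in place as left context. \<open>\<sigma>\<close> and \<open>\<tau>\<close> vary in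
  the induction, since each replayed step instantiates both the rest of the query and that
  body.\<close>

lemma resolved_first_diverges:
  assumes "resolved_first h B b U" "wf_subst L \<sigma>" "wf_subst L \<tau>"
    and "subst_atom \<sigma> b = subst_atom \<tau> h" "good (subst_query \<tau> B @ subst_query \<sigma> U)"
  shows "diverges (subst_query \<tau> B @ subst_query \<sigma> U)"
  using assms
proof (induction arbitrary: \<sigma> \<tau>)
  case (now h' B' \<theta> b U)
  obtain \<delta> where \<delta>: "wf_subst L \<delta>"
    "subst_query \<delta> (subst_query \<theta> (B' @ U)) = subst_query \<tau> B @ subst_query \<sigma> U"
    using matching_step_factor[OF now.hyps(1) now.prems(1-3)] by auto
  then show ?case
    using diverges_lift[OF now.hyps(2), of "[]" \<delta>] now.prems(4) by simp
next
  case (later k C k' C' \<theta> b U\<^sub>1 a U\<^sub>2)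
  have step: "matching_step k C k' C' \<theta> U\<^sub>1 a U\<^sub>2" and b: "vars_query (k' # C') \<inter> vars_atom b = {}"
    using matching_step_tail[OF later.hyps(1)] by auto
  obtain k'' C'' \<theta>' \<delta> where lift: "wf_subst L \<theta>'" "wf_subst L \<delta>"
    "matching_step k C k'' C'' \<theta>' (subst_query \<tau> B @ subst_query \<sigma> U\<^sub>1) (subst_atom \<sigma> a) (subst_query \<sigma> U\<^sub>2)"
    "subst_query \<theta>' ((subst_query \<tau> B @ subst_query \<sigma> U\<^sub>1) @ C'' @ subst_query \<sigma> U\<^sub>2) =
      subst_query \<theta>' (subst_query \<tau> B) @ subst_query \<delta> (subst_query \<theta> (U\<^sub>1 @ C' @ U\<^sub>2))"
    "\<And>x. x \<notin> vars_query (k' # C') \<Longrightarrow> (\<delta> \<odot> \<theta>) x = (\<theta>' \<odot> \<sigma>) x"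
    using matching_step_lift[OF step later.prems(4,1)] by metis
  have good: "good ((subst_query \<tau> B @ subst_query \<sigma> U\<^sub>1) @ subst_atom \<sigma> a # subst_query \<sigma> U\<^sub>2)"
    using later.prems(4) by simp
  \<comment> \<open>The variables of \<open>b\<close> avoid the clause variant of the step, so the
    factorisation applies to them although \<open>b\<close> has left the query. Hence
    \<open>\<delta>\<close> and \<open>\<theta>' \<odot> \<tau>\<close> equate the current instance
    of \<open>b\<close> with \<open>h\<close>, as the induction hypothesis requires.\<close>
  have "subst_atom (\<delta> \<odot> \<theta>) b = subst_atom (\<theta>' \<odot> \<sigma>) b"
    using b by (intro subst_atom_cong lift(5)) blast
  then have "subst_atom \<delta> (subst_atom \<theta> b) = subst_atom (\<theta>' \<odot> \<tau>) h"
    using later.prems(3) by (simp add: subst_atom_comp)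
  then have "diverges (subst_query (\<theta>' \<odot> \<tau>) B @ subst_query \<delta> (subst_query \<theta> (U\<^sub>1 @ C' @ U\<^sub>2)))"
    using good_resolvent[OF good lift(3)] lift(4) later.prems(2) lift(1,2)
    by (intro later.IH wf_subst_comp) (simp_all add: subst_query_comp)
  then have "diverges (subst_query \<theta>' ((subst_query \<tau> B @ subst_query \<sigma> U\<^sub>1) @ C'' @ subst_query \<sigma> U\<^sub>2))"
    unfolding lift(4) subst_query_comp .
  from diverges.intros[OF lift(3) this] show ?case
    by simp
qed

text \<open>Composing the mgus of the steps up to the resolution of \<open>b\<close> shows that the
  clause used later can be applied to \<open>b\<close> at once.\<close>

lemma resolved_first_unifiable:
  assumes "resolved_first h B b U"
  shows "(h, B) \<in> clauses P \<and>
    (\<exists>\<sigma> \<tau>. wf_subst L \<sigma> \<and> wf_subst L \<tau> \<and> subst_atom \<sigma> b = subst_atom \<tau> h)"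
  using assms
proof induction
  case (now h' B' \<theta> b U)
  then obtain \<rho> where "h' = subst_atom (Var \<circ> \<rho>) h"
    by (auto simp: matching_step_def)
  then have "subst_atom \<theta> b = subst_atom (\<theta> \<odot> (Var \<circ> \<rho>)) h" "wf_subst L \<theta>"
    using now by (auto simp: matching_step_def is_mgu_def unifier_def subst_atom_comp)
  then show ?case
    using now wf_subst_comp[of L \<theta> "Var \<circ> \<rho>"] by (auto simp: matching_step_def)
next
  case (later k C k' C' \<theta> b U\<^sub>1 a U\<^sub>2)
  then obtain \<sigma> \<tau> where "wf_subst L \<sigma>" "wf_subst L \<tau>" "subst_atom (\<sigma> \<odot> \<theta>) b = subst_atom \<tau> h"
    by (auto simp: subst_atom_comp)
  moreover have "wf_subst L \<theta>"
    using later by (auto simp: matching_step_def is_mgu_def unifier_def)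
  ultimately show ?case
    using later.IH wf_subst_comp by blast
qed

text \<open>No step can select the head atom, as \<open>now\<close> would then apply, and by
  \<open>later\<close> its instance after a step is never resolved either. Deleting it from every
  query leaves a derivation.\<close>

lemma diverges_without_first:
  assumes "diverges (b # U)" "\<And>h B. \<not> resolved_first h B b U"
  shows "diverges U"
proof -
  define X where "X U \<longleftrightarrow> (\<exists>b. diverges (b # U) \<and> (\<forall>h B. \<not> resolved_first h B b U))" for U
  have "X U"
    using assms by (auto simp: X_def)
  then show ?thesis
  proof (coinduct rule: diverges.coinduct)
    case (diverges U)
    then obtain b where b: "diverges (b # U)" "\<And>h B. \<not> resolved_first h B b U"
      by (auto simp: X_def)
    from b(1) obtain h B h' B' \<theta> Q\<^sub>1 a Q\<^sub>2 where Q: "b # U = Q\<^sub>1 @ a # Q\<^sub>2"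
      and step: "matching_step h B h' B' \<theta> Q\<^sub>1 a Q\<^sub>2" and div: "diverges (subst_query \<theta> (Q\<^sub>1 @ B' @ Q\<^sub>2))"
      by (auto elim: diverges.cases)
    obtain U\<^sub>1 where Q\<^sub>1: "Q\<^sub>1 = b # U\<^sub>1"
    proof (cases Q\<^sub>1)
      case Nil
      then have "resolved_first h B b U"
        using Q step div by (intro resolved_first.now) auto
      then show ?thesis
        using b(2) by blast
    qed (use Q in auto)
    have "\<not> resolved_first k C (subst_atom \<theta> b) (subst_query \<theta> (U\<^sub>1 @ B' @ Q\<^sub>2))" for k C
      using resolved_first.later[OF step[unfolded Q\<^sub>1]] b(2) Q Q\<^sub>1 by auto
    then have "X (subst_query \<theta> (U\<^sub>1 @ B' @ Q\<^sub>2))"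
      using div Q\<^sub>1 unfolding X_def by auto
    moreover have "U = U\<^sub>1 @ a # Q\<^sub>2"
      using Q Q\<^sub>1 by simp
    ultimately show ?case
      using matching_step_tail[OF step[unfolded Q\<^sub>1]] by blast
  qed
qed

text \<open>The input positions where some head has a non-variable term are of non-variable type, and a
  variable belongs to the variable type only.\<close>

lemma leftmost_ready:
  assumes "good (a # Q)"
  shows "ready a"
proof -
  have a: "wf_atom L a"
    using goodD(1)[OF assms] by (simp add: simply_moded_def)
  \<comment> \<open>Nothing stands to the left of \<open>a\<close>, so its guard is trivial and the
    identity substitution shows that its inputs are typed as they stand.\<close>
  have "ins_typed L (subst_atom Var a)"
    using goodD(2)[OF assms] wf_subst_Var(1) by (simp del: subst_atom_Var)
  then have ins: "ins_typed L a"
    by simp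
  have "\<not> is_Var (args a ! i)"
    if c: "(h, B) \<in> clauses P" "psym h = psym a" and i: "i \<in> positions L (psym h) Input"
      "\<not> is_Var (args h ! i)" for h B i
  proof
    assume "is_Var (args a ! i)"
    then obtain x where x: "args a ! i = Var x"
      by (auto simp: is_Var_def)
    let ?T = "ptype L (psym a) ! i"
    have "Var x \<in> ?T"
      using ins i(1) c(2) x by (auto simp: ins_typed_def)
    moreover have "is_type L ?T"
    proof -
      have "?T \<in> set (ptype L (psym a))"
        using language i(1) c(2) by (intro nth_mem) (auto simp: wf_language_def positions_def)
      then show ?thesis
        using language by (auto simp: wf_language_def)
    qed
    ultimately have "t \<in> ?T" if "wf_trm L t" for t
      using that unfolding is_type_def wf_subst_def
      by (auto dest!: bspec[of _ _ "Var x"] spec[of _ "\<lambda>_. t"])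
    then have "?T = variable_type L"
      using \<open>is_type L ?T\<close> by (auto simp: is_type_def variable_type_def)
    then show False
      using head_nonvar[OF c(1) i] c(2) by simp
  qed
  then show ?thesis
    using a by (auto simp: ready_def)
qed

section \<open>From divergence to an infinite leftmost derivation\<close>

lemma matching_step_LD:
  "matching_step h B h' B' \<theta> [] a Q \<Longrightarrow> LD_step L P (a # Q) (subst_query \<theta> (B' @ Q))"
  unfolding matching_step_def LD_step_def resolvent_def by fastforce

lemma diverges_LD_step:
  assumes good: "good Q" and "diverges Q"
  shows "\<exists>R. LD_step L P Q R \<and> good R \<and> diverges R"
proof -
  obtain b U where Q: "Q = b # U"
  proof (cases Q)
    case Nil
    with assms(2) show ?thesis
      by (cases rule: diverges.cases) simp
  qed
  have ready: "ready b"
    using leftmost_ready good Q by blast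
  \<comment> \<open>The resolvent is expressed through the original body, with
    \<open>\<theta> \<odot> (Var \<circ> \<rho>)\<close> in the role of \<open>\<tau>\<close> and
    \<open>\<theta>\<close> in that of \<open>\<sigma>\<close>. This is the shape of both the
    exchange result and lifting with the body as context.\<close>
  have front: "\<exists>\<theta> \<rho>. LD_step L P Q (subst_query (\<theta> \<odot> (Var \<circ> \<rho>)) B @ subst_query \<theta> U) \<and>
      good (subst_query (\<theta> \<odot> (Var \<circ> \<rho>)) B @ subst_query \<theta> U) \<and> wf_subst L \<theta> \<and>
      subst_atom \<theta> b = subst_atom (\<theta> \<odot> (Var \<circ> \<rho>)) h"
    if c: "(h, B) \<in> clauses P" and u: "subst_atom \<sigma> b = subst_atom \<tau> h" for h B \<sigma> \<tau>
  proof -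
    obtain \<mu> where \<mu>: "wf_subst L \<mu>" "map (subst_trm \<mu>) (ins L h) = ins L b"
      using matcher_ex_clause[OF ready c u] by metis
    have "psym h = psym b"
      using u by (metis psym_subst_atom)
    moreover have g: "good ([] @ b # U)"
      using good Q by simp
    ultimately obtain \<rho> \<theta> where step:
      "matching_step h B (subst_atom (Var \<circ> \<rho>) h) (subst_query (Var \<circ> \<rho>) B) \<theta> [] b U"
      using matching_step_ex[OF _ ready c _ \<mu>] by metis
    then have "wf_subst L \<theta>" "subst_atom \<theta> b = subst_atom \<theta> (subst_atom (Var \<circ> \<rho>) h)"
      by (auto simp: matching_step_def is_mgu_def unifier_def)
    then show ?thesis
      using matching_step_LD[OF step] good_resolvent[OF g step] Q
      by (intro exI[of _ \<theta>] exI[of _ \<rho>]) (simp add: subst_query_comp subst_atom_comp)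
  qed
  show ?thesis
  proof (cases "\<exists>h B. resolved_first h B b U")
    case True
    then obtain h B where r: "resolved_first h B b U"
      by blast
    then obtain \<sigma> \<tau> where u: "(h, B) \<in> clauses P" "subst_atom \<sigma> b = subst_atom \<tau> h"
      using resolved_first_unifiable by blast
    obtain \<theta> \<rho> where f: "LD_step L P Q (subst_query (\<theta> \<odot> (Var \<circ> \<rho>)) B @ subst_query \<theta> U)"
      "good (subst_query (\<theta> \<odot> (Var \<circ> \<rho>)) B @ subst_query \<theta> U)" "wf_subst L \<theta>"
      "subst_atom \<theta> b = subst_atom (\<theta> \<odot> (Var \<circ> \<rho>)) h"
      using front[OF u] by blast
    then show ?thesis
      using resolved_first_diverges[OF r f(3) wf_subst_comp[OF f(3)] f(4,2)] by auto
  next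
    case False
    then have div: "diverges U"
      using diverges_without_first assms(2) Q by blast
    have "simply_typed L [b]" "psym b \<in> preds P"
      using good Q by (auto simp: good_def simply_typed_def simply_moded_def)
    then obtain h B \<sigma> \<tau> where "(h, B) \<in> clauses P" "subst_atom \<sigma> b = subst_atom \<tau> h"
      using unifiable by blast
    from front[OF this] obtain \<theta> \<rho> where "LD_step L P Q (subst_query (\<theta> \<odot> (Var \<circ> \<rho>)) B @ subst_query \<theta> U)"
      "good (subst_query (\<theta> \<odot> (Var \<circ> \<rho>)) B @ subst_query \<theta> U)" "wf_subst L \<theta>"
      by blast
    then show ?thesis
      using diverges_lift[OF div] by blast
  qed
qed

lemma diverges_imp_infinite_LD:
  assumes "good Q" "diverges Q"
  shows "\<exists>\<xi>. infinite_derivation (LD_step L P) Q \<xi>"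
proof -
  \<comment> \<open>The conjunct for \<open>k = 0\<close> pins the start of the chosen sequence to
    \<open>Q\<close>.\<close>
  have "\<exists>\<xi>. \<forall>k. (good (\<xi> k) \<and> diverges (\<xi> k) \<and> (k = 0 \<longrightarrow> \<xi> k = Q)) \<and> LD_step L P (\<xi> k) (\<xi> (Suc k))"
    using assms diverges_LD_step by (intro dependent_nat_choice) auto
  then show ?thesis
    by (auto simp: infinite_derivation_def)
qed

end

section \<open>Permutation simply typed programs\<close>

lemma permute_query_nth:
  assumes "\<pi> permutes {1..length Q}" "k < length Q"
  shows "permute_query \<pi> Q ! k = nth_atom Q (inv \<pi> (Suc k))" "inv \<pi> (Suc k) \<in> {1..length Q}"
    "\<pi> (inv \<pi> (Suc k)) = Suc k"
proof -
  show "permute_query \<pi> Q ! k = nth_atom Q (inv \<pi> (Suc k))"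
    using assms(2) by (simp add: permute_query_def del: upt_Suc)
  show "inv \<pi> (Suc k) \<in> {1..length Q}"
    using permutes_in_image[OF permutes_inv[OF assms(1)], of "Suc k"] assms(2) by simp
  show "\<pi> (inv \<pi> (Suc k)) = Suc k"
    using permutes_inverses[OF assms(1)] by simp
qed

lemma length_permute_query [simp]: "length (permute_query \<pi> Q) = length Q"
  by (simp add: permute_query_def del: upt_Suc)

text \<open>Multisets link a query with its reordering: the simulation forgets positions altogether
  and remembers only which atoms are present.\<close>

lemma mset_permute_query:
  assumes "\<pi> permutes {1..length Q}"
  shows "mset (permute_query \<pi> Q) = mset Q"
proof -
  have Q: "map (nth_atom Q) [1..<Suc (length Q)] = Q"
  proof -
    have "[1..<Suc (length Q)] = map Suc [0..<length Q]"
      by (simp add: map_Suc_upt del: upt_Suc)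
    then show ?thesis
      using map_nth[of Q] by (simp add: comp_def del: upt_Suc)
  qed
  have up: "mset [1..<Suc (length Q)] = mset_set {1..length Q}"
    by (simp add: atLeastLessThanSuc_atLeastAtMost del: upt_Suc)
  have "mset (permute_query \<pi> Q) =
      image_mset (nth_atom Q) (image_mset (inv \<pi>) (mset [1..<Suc (length Q)]))"
    by (simp add: permute_query_def multiset.map_comp comp_def del: upt_Suc)
  also have "image_mset (inv \<pi>) (mset [1..<Suc (length Q)]) = mset [1..<Suc (length Q)]"
    unfolding up by (rule permutes_image_mset[OF permutes_inv[OF assms]])
  also have "image_mset (nth_atom Q) (mset [1..<Suc (length Q)]) = mset Q"
    using arg_cong[OF Q, of mset] by (simp del: upt_Suc)
  finally show ?thesis .
qed

lemma set_permute_query: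
  assumes "\<pi> permutes {1..length Q}"
  shows "set (permute_query \<pi> Q) = set Q"
  using mset_eq_setD[OF mset_permute_query[OF assms]] .

lemma left_modedI:
  assumes "\<And>i j. i \<le> j \<Longrightarrow> j < length Q \<Longrightarrow> vars_list (ins L (Q ! i)) \<inter> vars_list (outs L (Q ! j)) = {}"
  shows "left_moded L Q"
  using assms
proof (induction Q)
  case (Cons a Q)
  have "left_moded L Q"
    using Cons.prems[of "Suc _" "Suc _"] by (intro Cons.IH) simp
  moreover have "vars_list (ins L a) \<inter> vars_list (outs L b) = {}" if b: "b \<in> set (a # Q)" for b
  proof -
    obtain j where "j < length (a # Q)" "b = (a # Q) ! j"
      using b by (metis in_set_conv_nth)
    then show ?thesis
      using Cons.prems[of 0 j] by simp
  qed
  then have "vars_list (ins L a) \<inter> set (outvars L (a # Q)) = {}"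
    unfolding set_outvars by blast
  ultimately show ?case
    by simp
qed simp

lemma left_typedI:
  assumes "\<And>i \<sigma>. i < length Q \<Longrightarrow> wf_subst L \<sigma> \<Longrightarrow> G \<sigma> \<Longrightarrow>
    (\<And>j. j < i \<Longrightarrow> outs_typed L (subst_atom \<sigma> (Q ! j))) \<Longrightarrow> ins_typed L (subst_atom \<sigma> (Q ! i))"
  shows "left_typed L Q G"
  using assms
proof (induction Q arbitrary: G)
  case (Cons a Q)
  have "left_typed L Q (\<lambda>\<sigma>. G \<sigma> \<and> outs_typed L (subst_atom \<sigma> a))"
  proof (rule Cons.IH)
    fix i \<sigma>
    assume *: "i < length Q" "wf_subst L \<sigma>" "G \<sigma> \<and> outs_typed L (subst_atom \<sigma> a)"
      "\<And>j. j < i \<Longrightarrow> outs_typed L (subst_atom \<sigma> (Q ! j))"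
    have "outs_typed L (subst_atom \<sigma> ((a # Q) ! j))" if "j < Suc i" for j
      using that *(3,4) by (cases j) auto
    then show "ins_typed L (subst_atom \<sigma> (Q ! i))"
      using Cons.prems[of "Suc i" \<sigma>] * by simp
  qed
  then show ?case
    using Cons.prems[of 0] by simp
qed simp

lemma simply_moded_permute_query:
  assumes \<pi>: "\<pi> permutes {1..length Q}" and moded: "nicely_moded_query L \<pi> Q"
    and atoms: "\<forall>a\<in>set Q. wf_atom L a \<and> (\<forall>t\<in>set (outs L a). is_Var t)"
  shows "simply_moded L (permute_query \<pi> Q)"
proof -
  \<comment> \<open>The multiset of output variables depends only on the multiset of atoms, so
    linearity is unaffected by the reordering.\<close>
  have "mset (outvars L R) = \<Sum>\<^sub># (image_mset (\<lambda>a. mset (occs_list (outs L a))) (mset R))" for R :: "('a, 'b) query"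
    by (induction R) auto
  then have "mset (outvars L (permute_query \<pi> Q)) = mset (outvars L Q)"
    using mset_permute_query[OF \<pi>] by metis
  then have "distinct (outvars L (permute_query \<pi> Q))"
    using moded mset_eq_imp_distinct_iff
    by (auto simp: nicely_moded_query_def linear_def outvars_def)
  moreover have "left_moded L (permute_query \<pi> Q)"
  proof (rule left_modedI)
    fix k l assume kl: "k \<le> l" "l < length (permute_query \<pi> Q)"
    then have k: "k < length Q" and l: "l < length Q"
      by simp_all
    note pk = permute_query_nth[OF \<pi> k] and pl = permute_query_nth[OF \<pi> l]
    have "vars_list (ins L (nth_atom Q (inv \<pi> (Suc k)))) \<inter>
        (\<Union>j\<in>{j\<in>{1..length Q}. \<pi> (inv \<pi> (Suc k)) \<le> \<pi> j}. vars_list (outs L (nth_atom Q j))) = {}"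
      using moded pk(2) unfolding nicely_moded_query_def by blast
    moreover have "inv \<pi> (Suc l) \<in> {j\<in>{1..length Q}. \<pi> (inv \<pi> (Suc k)) \<le> \<pi> j}"
      using pl(2,3) pk(3) kl(1) by simp
    ultimately show "vars_list (ins L (permute_query \<pi> Q ! k)) \<inter> vars_list (outs L (permute_query \<pi> Q ! l)) = {}"
      unfolding pk(1) pl(1) by blast
  qed
  ultimately show ?thesis
    using atoms set_permute_query[OF \<pi>] by (simp add: simply_moded_def)
qed

text \<open>The atoms preceding atom \<open>i\<close> in the reordered query are those with
  \<open>\<pi> j < \<pi> i\<close>. The guard \<open>G\<close> is trivial for queries and states
  that the head inputs are typed for clause bodies.\<close>

lemma left_typed_permute_query:
  assumes \<pi>: "\<pi> permutes {1..length Q}"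
    and typed: "\<And>i \<sigma>. i \<in> {1..length Q} \<Longrightarrow> wf_subst L \<sigma> \<Longrightarrow> G \<sigma> \<Longrightarrow>
      (\<And>j. j \<in> {1..length Q} \<Longrightarrow> \<pi> j < \<pi> i \<Longrightarrow> outs_typed L (subst_atom \<sigma> (nth_atom Q j))) \<Longrightarrow>
      ins_typed L (subst_atom \<sigma> (nth_atom Q i))"
  shows "left_typed L (permute_query \<pi> Q) G"
proof (rule left_typedI)
  fix k \<sigma>
  assume k: "k < length (permute_query \<pi> Q)" and \<sigma>: "wf_subst L \<sigma>" "G \<sigma>"
    and outs: "\<And>l. l < k \<Longrightarrow> outs_typed L (subst_atom \<sigma> (permute_query \<pi> Q ! l))"
  note pk = permute_query_nth[OF \<pi> k[unfolded length_permute_query]]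
  show "ins_typed L (subst_atom \<sigma> (permute_query \<pi> Q ! k))"
    unfolding pk(1)
  proof (rule typed[OF pk(2) \<sigma>])
    fix j assume j: "j \<in> {1..length Q}" "\<pi> j < \<pi> (inv \<pi> (Suc k))"
    have "\<pi> j \<in> {1..length Q}"
      using permutes_in_image[OF \<pi>] j(1) by blast
    then obtain l where l: "\<pi> j = Suc l" "l < length Q"
      by (cases "\<pi> j") auto
    have "inv \<pi> (Suc l) = j"
      using permutes_inverses(2)[OF \<pi>, of j] l(1) by simp
    then show "outs_typed L (subst_atom \<sigma> (nth_atom Q j))"
      using outs[of l] permute_query_nth(1)[OF \<pi> l(2)] j(2) l(1) pk(3) by simp
  qed
qed

lemma simply_typed_permute_query:
  assumes "pi_simply_typed_query L \<pi> Q" "\<forall>a\<in>set Q. wf_atom L a"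
  shows "simply_typed L (permute_query \<pi> Q)"
  unfolding simply_typed_def
proof (rule conjI)
  show "simply_moded L (permute_query \<pi> Q)"
    using assms by (intro simply_moded_permute_query) (auto simp: pi_simply_typed_query_def)
  show "left_typed L (permute_query \<pi> Q) (\<lambda>_. True)"
    using assms(1) unfolding pi_simply_typed_query_def well_typed_query_def
    by (intro left_typed_permute_query) blast+
qed

lemma moded_clause_permute_query:
  assumes c: "pi_simply_typed_clause L \<pi> (h, B)" and wf: "\<forall>a\<in>set (h # B). wf_atom L a"
  shows "moded_clause L h (permute_query \<pi> B)"
proof -
  have \<pi>: "\<pi> permutes {1..length B}"
    using c by simp
  have "vars_list (ins L h) \<inter> vars_list (outs L b) = {}" if b: "b \<in> set B" for b
  proof -
    obtain j where "j < length B" "b = B ! j"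
      using b by (metis in_set_conv_nth)
    then have j: "Suc j \<in> {1..length B}" "b = nth_atom B (Suc j)"
      by simp_all
    have "vars_list (ins L h) \<inter> (\<Union>j\<in>{1..length B}. vars_list (outs L (nth_atom B j))) = {}"
      using c by simp
    then show ?thesis
      using j by blast
  qed
  then have "vars_list (ins L h) \<inter> set (outvars L (permute_query \<pi> B)) = {}"
    unfolding set_outvars set_permute_query[OF \<pi>] by blast
  moreover have "simply_moded L (permute_query \<pi> B)"
    using c wf by (intro simply_moded_permute_query) auto
  ultimately show ?thesis
    using wf by (simp add: moded_clause_def)
qed

lemma typed_clause_permute_query:
  assumes c: "pi_simply_typed_clause L \<pi> (h, B)"
  shows "typed_clause L h (permute_query \<pi> B)"
proof -
  have \<pi>: "\<pi> permutes {1..length B}" and wt: "well_typed_clause L \<pi> (h, B)"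
    using c by simp_all
  \<comment> \<open>As \<open>\<pi>\<close> fixes \<open>0\<close> and \<open>n + 1\<close>, the
    head inputs precede every body atom and the head outputs follow them all.\<close>
  have \<pi>0: "\<pi> 0 = 0" "\<pi> (length B + 1) = length B + 1"
    using \<pi> by (simp_all add: permutes_not_in)
  have consumed: "consumed_typed L h B \<sigma> i"
    if i: "i \<in> {1..length B + 1}" and \<sigma>: "wf_subst L \<sigma>" "ins_typed L (subst_atom \<sigma> h)"
      and outs: "\<And>j. j \<in> {1..length B} \<Longrightarrow> \<pi> j < \<pi> i \<Longrightarrow> outs_typed L (subst_atom \<sigma> (nth_atom B j))"
    for i \<sigma>
  proof -
    have "\<forall>j\<in>{0..length B}. \<pi> j < \<pi> i \<longrightarrow> produced_typed L h B \<sigma> j"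
    proof (intro ballI impI)
      fix j assume j: "j \<in> {0..length B}" "\<pi> j < \<pi> i"
      show "produced_typed L h B \<sigma> j"
      proof (cases "j = 0")
        case False
        then have "j \<in> {1..length B}"
          using j(1) by simp
        then show ?thesis
          using outs j(2) False unfolding produced_typed_def by presburger
      qed (use \<sigma>(2) in \<open>simp add: produced_typed_def\<close>)
    qed
    then show ?thesis
      using wt i \<sigma>(1) unfolding well_typed_clause.simps by blast
  qed
  have "left_typed L (permute_query \<pi> B) (\<lambda>\<sigma>. ins_typed L (subst_atom \<sigma> h))"
  proof (rule left_typed_permute_query[OF \<pi>])
    fix i \<sigma>
    assume "i \<in> {1..length B}" "wf_subst L \<sigma>" "ins_typed L (subst_atom \<sigma> h)"
      "\<And>j. j \<in> {1..length B} \<Longrightarrow> \<pi> j < \<pi> i \<Longrightarrow> outs_typed L (subst_atom \<sigma> (nth_atom B j))"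
    with consumed[of i \<sigma>] show "ins_typed L (subst_atom \<sigma> (nth_atom B i))"
      by (simp add: consumed_typed_def)
  qed
  moreover have "outs_typed L (subst_atom \<sigma> h)"
    if "wf_subst L \<sigma>" "ins_typed L (subst_atom \<sigma> h)" "\<forall>b\<in>set B. outs_typed L (subst_atom \<sigma> b)" for \<sigma>
  proof -
    have "nth_atom B j \<in> set B" if "j \<in> {1..length B}" for j
      using that by auto
    then show ?thesis
      using consumed[of "length B + 1" \<sigma>] that by (simp add: consumed_typed_def)
  qed
  ultimately show ?thesis
    by (simp add: typed_clause_def set_permute_query[OF \<pi>])
qed

lemma simply_typed_atomI:
  assumes "simply_typed L [a]"
  shows "simply_typed_atom L a"
proof -
  have "left_typed L [a] (\<lambda>_. True)" "simply_moded L [a]"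
    using assms by (auto simp: simply_typed_def)
  moreover have "{1..length [a]} = {1}"
    by auto
  ultimately show ?thesis
    unfolding simply_typed_atom_def pi_simply_typed_query_def nicely_moded_query_def well_typed_query_def
    by (auto simp: permutes_id simply_moded_def linear_def vars_list_def)
qed

section \<open>Transfer from \<open>P\<close> to \<open>P'\<close>\<close>

locale corresponding_programs =
  fixes L :: "('f, 'p) language" and P P' :: "('f, 'p) program"
  assumes language: "wf_language L" and program: "wf_program L P"
    and non_speculative: "non_speculative L P"
    and input_selectability: "input_selectability L P"
    and corresponding: "corresponding_program L P P'"
begin

lemma clause_of_corresponding:
  assumes "(h, B) \<in> clauses P"
  obtains \<pi> where "(h, permute_query \<pi> B) \<in> clauses P'" "pi_simply_typed_clause L \<pi> (h, B)"
proof -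
  obtain f where f: "\<forall>c\<in>clauses P. corresponding_clause L c (f c)" "P' = P\<lparr>clauses := f ` clauses P\<rparr>"
    using corresponding by (auto simp: corresponding_program_def)
  have "corresponding_clause L (h, B) (f (h, B))"
    using f(1) assms by blast
  moreover have "f (h, B) \<in> clauses P'"
    using f(2) assms by simp
  ultimately show thesis
    using that by auto
qed

lemma clause_of_original:
  assumes "(h, B') \<in> clauses P'"
  obtains \<pi> B where "(h, B) \<in> clauses P" "pi_simply_typed_clause L \<pi> (h, B)" "B' = permute_query \<pi> B"
proof -
  obtain f where f: "\<forall>c\<in>clauses P. corresponding_clause L c (f c)" "P' = P\<lparr>clauses := f ` clauses P\<rparr>"
    using corresponding by (auto simp: corresponding_program_def)
  obtain h\<^sub>0 B where c: "(h\<^sub>0, B) \<in> clauses P" "f (h\<^sub>0, B) = (h, B')"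
    using assms f(2) by auto
  then have "corresponding_clause L (h\<^sub>0, B) (h, B')"
    using f(1) by metis
  then show thesis
    using that c(1) by auto
qed

lemma preds_eq: "preds P' = preds P"
proof
  show "preds P \<subseteq> preds P'"
  proof
    fix p assume "p \<in> preds P"
    then obtain h B where c: "(h, B) \<in> clauses P" "p \<in> psym ` set (h # B)"
      unfolding preds_def by blast
    then obtain \<pi> where "(h, permute_query \<pi> B) \<in> clauses P'" "pi_simply_typed_clause L \<pi> (h, B)"
      using clause_of_corresponding by blast
    moreover from this have "p \<in> psym ` set (h # permute_query \<pi> B)"
      using c(2) set_permute_query[of \<pi> B] by simp
    ultimately show "p \<in> preds P'"
      unfolding preds_def by blast
  qed
  show "preds P' \<subseteq> preds P"
  proof
    fix p assume "p \<in> preds P'"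
    then obtain h B' where c: "(h, B') \<in> clauses P'" "p \<in> psym ` set (h # B')"
      unfolding preds_def by blast
    then obtain \<pi> B where "(h, B) \<in> clauses P" "pi_simply_typed_clause L \<pi> (h, B)" "B' = permute_query \<pi> B"
      using clause_of_original by blast
    moreover from this have "p \<in> psym ` set (h # B)"
      using c(2) set_permute_query[of \<pi> B] by simp
    ultimately show "p \<in> preds P"
      unfolding preds_def by blast
  qed
qed

sublocale simply_typed_program L P'
proof
  show "wf_language L"
    by (rule language)
next
  fix h B' assume "(h, B') \<in> clauses P'"
  then obtain \<pi> B where c: "(h, B) \<in> clauses P" "pi_simply_typed_clause L \<pi> (h, B)" "B' = permute_query \<pi> B"
    by (rule clause_of_original)
  show "linear (ins L h)"
    using non_speculative c(1) by (auto simp: non_speculative_def input_linear_program_def)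
  have wf: "\<forall>a\<in>set (h # B). wf_atom L a"
    using program c(1) unfolding wf_program_def by blast
  show "moded_clause L h B'"
    unfolding c(3) by (rule moded_clause_permute_query[OF c(2) wf])
  show "typed_clause L h B'"
    unfolding c(3) by (rule typed_clause_permute_query[OF c(2)])
  fix i assume "i \<in> positions L (psym h) Input"
  then show "flat (args h ! i)" "\<not> is_Var (args h ! i) \<Longrightarrow> ptype L (psym h) ! i \<noteq> variable_type L"
    using c(2) by auto
next
  fix a assume a: "simply_typed L [a]" "psym a \<in> preds P'"
  have "wf_atom L a"
    using a(1) by (simp add: simply_typed_def simply_moded_def)
  then obtain c h B \<theta> where c: "c \<in> clauses P" "is_variant (h, B) c" "unifier L \<theta> a h"
    using non_speculative simply_typed_atomI[OF a(1)] a(2) preds_eq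
    unfolding non_speculative_def by blast
  obtain h\<^sub>0 B\<^sub>0 where c0: "c = (h\<^sub>0, B\<^sub>0)"
    by (cases c)
  obtain \<rho> where "h = subst_atom (Var \<circ> \<rho>) h\<^sub>0"
    using variantD c(2) unfolding c0 by metis
  \<comment> \<open>Reordering leaves heads unchanged, so the head found in \<open>P\<close> also
    occurs in \<open>P'\<close>; the renaming of the variant is absorbed into the substitution on
    the clause side.\<close>
  then have "subst_atom \<theta> a = subst_atom (\<theta> \<odot> (Var \<circ> \<rho>)) h\<^sub>0" "wf_subst L \<theta>"
    using c(3) by (auto simp: unifier_def subst_atom_comp)
  then show "\<exists>h B \<sigma> \<tau>. (h, B) \<in> clauses P' \<and> wf_subst L \<sigma> \<and> wf_subst L \<tau> \<and>
      subst_atom \<sigma> a = subst_atom \<tau> h"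
    using clause_of_corresponding[OF c(1)[unfolded c0]] wf_subst_comp[of L \<theta> "Var \<circ> \<rho>"]
    by (metis wf_subst_Var(2))
qed

text \<open>All outputs in a good query are variables, so input selectability applies and makes
  every bound input position non-variable. Since \<open>P\<close> and \<open>P'\<close> have the
  same heads, these are the positions that readiness concerns.\<close>

lemma selectable_ready:
  assumes "good Q" "a \<in> set Q" "selectable P a"
  shows "ready a"
proof -
  have a: "wf_atom L a" "\<forall>t\<in>set (outs L a). is_Var t" "psym a \<in> preds P"
    using assms(1,2) preds_eq by (auto simp: good_def simply_typed_def simply_moded_def)
  have "is_Var (args a ! i)" if "i \<in> positions L (psym a) Output" for i
    using that a(1,2) set_outs[of a L] by (auto simp: wf_atom_def)
  then have nonvar: "\<not> is_Var (args a ! i)"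
    if "i \<in> positions L (psym a) Input" "bound_position L P (psym a) i" for i
    using input_selectability a assms(3) that unfolding input_selectability_def by blast
  have "\<not> is_Var (args a ! i)"
    if "(h, B') \<in> clauses P'" "psym h = psym a" "i \<in> positions L (psym h) Input" "\<not> is_Var (args h ! i)"
    for h B' i
  proof (rule nonvar)
    note h = that
    obtain B where "(h, B) \<in> clauses P"
      using clause_of_original[OF h(1)] by blast
    then show "bound_position L P (psym a) i"
      using h by (auto simp: bound_position_def)
  qed (use that in simp)
  then show ?thesis
    using a(1) by (auto simp: ready_def)
qed

text \<open>The same atom is resolved with the same mgu, but the reordered body is inserted where
  the atom stands in \<open>Z\<close>. Orders may thus diverge from step to step, while the
  multisets of atoms agree exactly.\<close>

lemma delay_respecting_step_simulated:
  assumes step: "delay_respecting_step L P R R'" and eq: "mset Z = mset R" and good: "good Z"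
  shows "\<exists>h B h' B' \<theta> Z\<^sub>1 a Z\<^sub>2. Z = Z\<^sub>1 @ a # Z\<^sub>2 \<and> matching_step h B h' B' \<theta> Z\<^sub>1 a Z\<^sub>2 \<and>
    mset (subst_query \<theta> (Z\<^sub>1 @ B' @ Z\<^sub>2)) = mset R'"
proof -
  obtain R\<^sub>1 a R\<^sub>2 where R: "R = R\<^sub>1 @ a # R\<^sub>2" "selectable P a" "resolvent L P R\<^sub>1 a R\<^sub>2 R'"
    using step by (auto simp: delay_respecting_step_def)
  obtain c h' B' \<theta> where c: "c \<in> clauses P" "is_variant (h', B') c"
    "vars_query (h' # B') \<inter> vars_query (R\<^sub>1 @ a # R\<^sub>2) = {}" "is_mgu L \<theta> a h'"
    "R' = subst_query \<theta> (R\<^sub>1 @ B' @ R\<^sub>2)"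
    using R(3) unfolding resolvent_def by blast
  obtain h B where hB: "c = (h, B)"
    by (cases c)
  obtain \<rho> where \<rho>: "bij \<rho>" "h' = subst_atom (Var \<circ> \<rho>) h" "B' = subst_query (Var \<circ> \<rho>) B"
    using variantD c(2) unfolding hB by metis
  obtain \<pi> where \<pi>: "(h, permute_query \<pi> B) \<in> clauses P'" "pi_simply_typed_clause L \<pi> (h, B)"
    using clause_of_corresponding c(1) unfolding hB by metis
  \<comment> \<open>Renaming the reordered body by the same \<open>\<rho>\<close> keeps
    \<open>h'\<close>, \<open>\<theta>\<close> and the variables involved, so renaming apart carries
    over.\<close>
  define C where "C = subst_query (Var \<circ> \<rho>) (permute_query \<pi> B)"
  have C: "mset C = mset B'"
    using mset_permute_query[of \<pi> B] \<pi>(2) by (simp add: C_def \<rho>(3) subst_query_def)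
  have "a \<in> set Z"
    using mset_eq_setD[OF eq] R(1) by simp
  then obtain Z\<^sub>1 Z\<^sub>2 where Z: "Z = Z\<^sub>1 @ a # Z\<^sub>2"
    by (meson split_list)
  have rest: "mset Z\<^sub>1 + mset Z\<^sub>2 = mset R\<^sub>1 + mset R\<^sub>2"
    using eq R(1) Z by simp
  have "vars_query (h' # C) = vars_query (h' # B')" "vars_query Z = vars_query R"
    using mset_eq_setD[OF C] mset_eq_setD[OF eq] by (simp_all add: vars_query_def)
  then have "vars_query (h' # C) \<inter> vars_query (Z\<^sub>1 @ a # Z\<^sub>2) = {}"
    using c(3) R(1) Z by simp
  moreover have "is_variant (h', C) (h, permute_query \<pi> B)"
    using \<rho>(1,2) by (auto simp: C_def)
  ultimately have "matching_step h (permute_query \<pi> B) h' C \<theta> Z\<^sub>1 a Z\<^sub>2"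
    using \<pi>(1) c(4) selectable_ready[OF good \<open>a \<in> set Z\<close> R(2)] by (simp add: matching_step_def)
  moreover have "mset (Z\<^sub>1 @ C @ Z\<^sub>2) = mset (R\<^sub>1 @ B' @ R\<^sub>2)"
    using rest C by (simp add: ac_simps)
  then have "mset (subst_query \<theta> (Z\<^sub>1 @ C @ Z\<^sub>2)) = mset R'"
    unfolding c(5) subst_query_def mset_map by simp
  ultimately show ?thesis
    using Z by (intro exI conjI)
qed

lemma infinite_derivation_diverges:
  assumes \<xi>: "infinite_derivation (delay_respecting_step L P) Q \<xi>" and Z: "mset Z = mset Q" "good Z"
  shows "diverges Z"
proof -
  define X where "X Z \<longleftrightarrow> (\<exists>k. mset Z = mset (\<xi> k)) \<and> good Z" for Z
  have "X Z"
    using \<xi> Z by (auto simp: infinite_derivation_def X_def intro!: exI[of _ 0])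
  then show ?thesis
  proof (coinduct rule: diverges.coinduct)
    case (diverges Z)
    then obtain k where k: "mset Z = mset (\<xi> k)" "good Z"
      by (auto simp: X_def)
    have "delay_respecting_step L P (\<xi> k) (\<xi> (Suc k))"
      using \<xi> by (simp add: infinite_derivation_def)
    then obtain h B h' B' \<theta> Z\<^sub>1 a Z\<^sub>2 where s: "Z = Z\<^sub>1 @ a # Z\<^sub>2" "matching_step h B h' B' \<theta> Z\<^sub>1 a Z\<^sub>2"
      "mset (subst_query \<theta> (Z\<^sub>1 @ B' @ Z\<^sub>2)) = mset (\<xi> (Suc k))"
      using delay_respecting_step_simulated[OF _ k] by blast
    then have "good (subst_query \<theta> (Z\<^sub>1 @ B' @ Z\<^sub>2))"
      using good_resolvent[OF _ s(2)] k(2) s(1) by simp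
    with s(3) have "X (subst_query \<theta> (Z\<^sub>1 @ B' @ Z\<^sub>2))"
      by (auto simp: X_def)
    then show ?case
      using s(1,2) by blast
  qed
qed

end

theorem theorem4p8:
  fixes L :: "('f, 'p) language" and P P' :: "('f, 'p) program" and Q Q' :: "('f, 'p) query"
  assumes "wf_language L" and "wf_program L P" and "query_for L P Q"
    and "non_speculative L P" and "input_selectability L P"
    and "corresponding_program L P P'"
    and "perm_simply_typed_query L Q" and "corresponding_query L Q Q'"
    and "\<exists>\<xi>. infinite_derivation (delay_respecting_step L P) Q \<xi>"
  shows "\<exists>\<xi>. infinite_derivation (LD_step L P') Q' \<xi>"
proof -
  interpret corresponding_programs L P P'
    using assms by unfold_locales
  obtain \<pi> where \<pi>: "pi_simply_typed_query L \<pi> Q" "Q' = permute_query \<pi> Q"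
    using assms(8) by (auto simp: corresponding_query_def)
  then have perm: "\<pi> permutes {1..length Q}"
    by (simp add: pi_simply_typed_query_def)
  have good: "good Q'"
    using assms(3) simply_typed_permute_query[OF \<pi>(1)] set_permute_query[OF perm] preds_eq \<pi>(2)
    by (auto simp: good_def query_for_def)
  have "mset Q' = mset Q"
    using mset_permute_query[OF perm] \<pi>(2) by simp
  then show ?thesis
    using diverges_imp_infinite_LD[OF good] infinite_derivation_diverges[OF _ _ good] assms(9) by blast
qed

end
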